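(* Let $(\Omega,\mathcal{F},\mu)$ be a probability space, let $\rho_1,\rho_2:L^1(\mu)\to\mathbb{R}$ be two finite (i.e. real-valued) convex expectations defined on $L^1(\mu)$, let $K_1,K_2\in L^1(\mu)$ with $0\le K_1<K_2$, and let $\alpha\in\mathbb{R}$ with $\rho_1(K_1)\le\alpha\le\rho_1(K_2)$. Put $\mathcal{X}_\alpha=\{X\in L^1(\mu):K_1\le X\le K_2,\ \rho_1(X)\le\alpha\}$, and call $X^*\in\mathcal{X}_\alpha$ an optimal test if $\rho_2(K_2-X^* )=\inf_{X\in\mathcal{X}_\alpha}\rho_2(K_2-X)$. Then an optimal test exists. Moreover, there exist $P^*\in\mathcal{P}$ and $Q^*\in\mathcal{Q}$ such that every optimal test $X^*$ can be expressed as $$X^*=K_2 I_{\{H_{Q^*}>zG_{P^*}\}}+B\,I_{\{H_{Q^*}=zG_{P^*}\}}+K_1 I_{\{H_{Q^*}<zG_{P^*}\}},\quad \mu\text{-a.e.},$$ for some $z\in[0,+\infty)\cup\{+\infty\}$ and some random variable $B$ taking values in the random interval $[K_1,K_2]$.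
   Context: (In)equalities between random variables are understood $\mu$-a.e.; $I_A$ is the indicator of $A$. A mapping $\rho:L^1(\mu)\to\mathbb{R}$ is a convex expectation on $L^1(\mu)$ if for all $X,Y\in L^1(\mu)$: (i) $X\ge Y$ implies $\rho(X)\ge\rho(Y)$; (ii) $\rho(X+c)=\rho(X)+c$ for every constant $c$; (iii) $\rho(\lambda X+(1-\lambda)Y)\le\lambda\rho(X)+(1-\lambda)\rho(Y)$ for $\lambda\in[0,1]$. $\mathcal{M}$ is the set of probability measures on $(\Omega,\mathcal{F})$ absolutely continuous with respect to $\mu$; $G_P=\frac{dP}{d\mu}$, $H_Q=\frac{dQ}{d\mu}$. For $P\in\mathcal{M}$ with $\frac{dP}{d\mu}\in L^\infty(\mu)$ put $\rho_i^*(P)=\sup_{X\in L^1(\mu)}(E_P[X]-\rho_i(X))\in(-\infty,+\infty]$, $i=1,2$. Then $\mathcal{P}=\{P\in\mathcal{M}:\frac{dP}{d\mu}\in L^\infty(\mu),\ \rho_1^*(P)<\infty\}$ and $\mathcal{Q}=\{Q\in\mathcal{M}:\frac{dQ}{d\mu}\in L^\infty(\mu),\ \rho_2^*(Q)<\infty\}$. Convention for $z=+\infty$: comparing $H_{Q^*}$ with $zG_{P^*}$ means comparing $z^{-1}H_{Q^*}$ with $G_{P^*}$ where $z^{-1}=0$; i.e. $\{H_{Q^*}>zG_{P^*}\}=\emptyset$, $\{H_{Q^*}=zG_{P^*}\}=\{G_{P^*}=0\}$, $\{H_{Q^*}<zG_{P^*}\}=\{G_{P^*}>0\}$. *)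

theory Defs
  imports "HOL-Probability.Probability"
begin

text \<open>
  Elements of $L^1(\mu)$ are represented by integrable functions. Monotonicity is stated with
  the almost-everywhere order, so a convex expectation takes the same value on functions that
  are equal almost everywhere; its values on non-integrable functions are unconstrained and
  never used.
\<close>

definition convex_expectation :: "'a measure \<Rightarrow> (('a \<Rightarrow> real) \<Rightarrow> real) \<Rightarrow> bool" where
  "convex_expectation M \<rho> \<longleftrightarrow>
     (\<forall>X Y. integrable M X \<longrightarrow> integrable M Y \<longrightarrow> (AE x in M. X x \<ge> Y x) \<longrightarrow> \<rho> X \<ge> \<rho> Y) \<and>
     (\<forall>X c. integrable M X \<longrightarrow> \<rho> (\<lambda>x. X x + c) = \<rho> X + c) \<and>
     (\<forall>X Y l. integrable M X \<longrightarrow> integrable M Y \<longrightarrow> 0 \<le> l \<longrightarrow> l \<le> 1 \<longrightarrow>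
        \<rho> (\<lambda>x. l * X x + (1 - l) * Y x) \<le> l * \<rho> X + (1 - l) * \<rho> Y)"

definition ac_prob_measures :: "'a measure \<Rightarrow> 'a measure set" where
  "ac_prob_measures M = {P. prob_space P \<and> sets P = sets M \<and> absolutely_continuous M P}"

text \<open>
  The convex conjugate of \<open>\<rho>\<close>. It is meant for \<open>P\<close> with an essentially bounded density
  with respect to \<open>M\<close>: every \<open>M\<close>-integrable function is then \<open>P\<close>-integrable, so that the
  Bochner integral below is a genuine expectation.
\<close>

definition convex_conjugate :: "'a measure \<Rightarrow> (('a \<Rightarrow> real) \<Rightarrow> real) \<Rightarrow> 'a measure \<Rightarrow> ereal" where
  "convex_conjugate M \<rho> P = (SUP X\<in>{X. integrable M X}. ereal ((\<integral>x. X x \<partial>P) - \<rho> X))"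

definition representing_measures ::
    "'a measure \<Rightarrow> (('a \<Rightarrow> real) \<Rightarrow> real) \<Rightarrow> 'a measure set" where
  "representing_measures M \<rho> =
     {P \<in> ac_prob_measures M.
        (\<exists>C::real. AE x in M. RN_deriv M P x \<le> ennreal C) \<and> convex_conjugate M \<rho> P < \<infinity>}"

definition feasible_tests ::
    "'a measure \<Rightarrow> (('a \<Rightarrow> real) \<Rightarrow> real) \<Rightarrow> ('a \<Rightarrow> real) \<Rightarrow> ('a \<Rightarrow> real) \<Rightarrow> real \<Rightarrow> ('a \<Rightarrow> real) set" where
  "feasible_tests M \<rho>\<^sub>1 K\<^sub>1 K\<^sub>2 \<alpha> =
     {X. integrable M X \<and> (AE x in M. K\<^sub>1 x \<le> X x \<and> X x \<le> K\<^sub>2 x) \<and> \<rho>\<^sub>1 X \<le> \<alpha>}"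

text \<open>
  The real infimum below is that of a set bounded below by \<open>\<rho>\<^sub>2 (\<lambda>x. 0)\<close>, by monotonicity,
  whenever \<open>K\<^sub>2\<close> is integrable and \<open>\<rho>\<^sub>2\<close> is a convex expectation.
\<close>

definition optimal_test ::
    "'a measure \<Rightarrow> (('a \<Rightarrow> real) \<Rightarrow> real) \<Rightarrow> (('a \<Rightarrow> real) \<Rightarrow> real) \<Rightarrow>
     ('a \<Rightarrow> real) \<Rightarrow> ('a \<Rightarrow> real) \<Rightarrow> real \<Rightarrow> ('a \<Rightarrow> real) \<Rightarrow> bool" where
  "optimal_test M \<rho>\<^sub>1 \<rho>\<^sub>2 K\<^sub>1 K\<^sub>2 \<alpha> X \<longleftrightarrow>
     X \<in> feasible_tests M \<rho>\<^sub>1 K\<^sub>1 K\<^sub>2 \<alpha> \<and>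
     \<rho>\<^sub>2 (\<lambda>x. K\<^sub>2 x - X x) = (INF Y\<in>feasible_tests M \<rho>\<^sub>1 K\<^sub>1 K\<^sub>2 \<alpha>. \<rho>\<^sub>2 (\<lambda>x. K\<^sub>2 x - Y x))"

text \<open>
  \<open>lr_scale z H G\<close> is the pair to be compared when \<open>H\<close> is compared with \<open>z * G\<close>: for
  \<open>z = \<infinity>\<close> it is \<open>(0, G)\<close>, i.e. \<open>z\<inverse> * H\<close> with \<open>z\<inverse> = 0\<close> is compared with \<open>G\<close>. Simply
  evaluating \<open>\<infinity> * G\<close> in \<^typ>\<open>ennreal\<close> would instead put the points with \<open>G = 0 < H\<close> into
  the region where \<open>H\<close> is the larger one.
\<close>

definition lr_scale :: "ennreal \<Rightarrow> ennreal \<Rightarrow> ennreal \<Rightarrow> ennreal \<times> ennreal" where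
  "lr_scale z H G = (if z = \<infinity> then (0, G) else (H, z * G))"

definition lr_greater :: "'a measure \<Rightarrow> 'a measure \<Rightarrow> 'a measure \<Rightarrow> ennreal \<Rightarrow> 'a set" where
  "lr_greater M P Q z =
     {x \<in> space M. case lr_scale z (RN_deriv M Q x) (RN_deriv M P x) of (h, g) \<Rightarrow> h > g}"

definition lr_equal :: "'a measure \<Rightarrow> 'a measure \<Rightarrow> 'a measure \<Rightarrow> ennreal \<Rightarrow> 'a set" where
  "lr_equal M P Q z =
     {x \<in> space M. case lr_scale z (RN_deriv M Q x) (RN_deriv M P x) of (h, g) \<Rightarrow> h = g}"

definition lr_less :: "'a measure \<Rightarrow> 'a measure \<Rightarrow> 'a measure \<Rightarrow> ennreal \<Rightarrow> 'a set" where
  "lr_less M P Q z =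
     {x \<in> space M. case lr_scale z (RN_deriv M Q x) (RN_deriv M P x) of (h, g) \<Rightarrow> h < g}"

end

theory Submission
  imports Defs
begin

text \<open>
  A monotone, real-valued convex functional on \<open>L\<^sup>1\<close> is automatically continuous. Hence an optimal test
  is the limit of convex combinations of a minimizing sequence, obtained here without weak
  compactness from almost minimal \<open>L\<^sup>2\<close>-norms. Separating a convex subset of the plane from the
  origin gives multipliers \<open>a, b \<ge> 0\<close>, not both zero, such that every optimal test minimizes
  \<open>a * \<rho>\<^sub>2 (K\<^sub>2 - X) + b * \<rho>\<^sub>1 X\<close> over the whole interval \<open>[K\<^sub>1, K\<^sub>2]\<close>. Two applications of a
  Hahn--Banach sandwich replace \<open>\<rho>\<^sub>1\<close> and \<open>\<rho>\<^sub>2\<close> by affine minorants without lowering this minimum;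
  their linear parts are expectations under measures \<open>P\<close>, \<open>Q\<close> with bounded densities \<open>G\<close>, \<open>H\<close>. Every
  optimal test thus minimizes \<open>\<integral> (b G - a H) X d\<mu>\<close> over \<open>[K\<^sub>1, K\<^sub>2]\<close>, which is the likelihood ratio
  form with \<open>z = b / a\<close>; \<open>a\<close>, \<open>b\<close>, \<open>P\<close> and \<open>Q\<close> do not depend on the test.
\<close>

section \<open>Linear functionals below sublinear ones\<close>

text \<open>\<open>\<alpha>\<close> may equal \<open>\<rho>\<^sub>1 K\<^sub>1\<close>, the least
  value of \<open>\<rho>\<^sub>1\<close> on the interval, so no test need satisfy the constraint
  strictly and the weight \<open>a\<close> of the risk may vanish. This case is what
  \<open>z = \<infinity>\<close> stands for, and it obliges the separation step to supply a measure
  even for a functional of weight zero. The two functionals are linearised one at a time: while one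
  is replaced, the other, or its replacement, enters through its upper graph as a convex set of
  pairs, so one separation result serves both and takes the place of a minimax theorem. The
  measure-theoretic properties of the linear parts come from growth: the linear part of an affine
  minorant must be monotone and send the constant one to one, hence is itself a convex expectation,
  and automatic continuity applied to it yields countable additivity and the bounded density.
  Elements of L1 are functions here, not classes, so Hahn--Banach is carried out on sets of
  functions closed under the linear operations.\<close>

definition fun_subspace :: "('a \<Rightarrow> real) set \<Rightarrow> bool" where
  "fun_subspace V \<longleftrightarrow> (\<lambda>_. 0) \<in> V \<and> (\<forall>x\<in>V. \<forall>y\<in>V. (\<lambda>w. x w + y w) \<in> V) \<and>
     (\<forall>x\<in>V. \<forall>t. (\<lambda>w. t * x w) \<in> V)"

text \<open>Homogeneity is required for strictly positive factors only. The value zero at the zero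
  function is a consequence, because doubling that function does not change it.\<close>

definition sublinear_on :: "('a \<Rightarrow> real) set \<Rightarrow> (('a \<Rightarrow> real) \<Rightarrow> real) \<Rightarrow> bool" where
  "sublinear_on V q \<longleftrightarrow> (\<forall>x\<in>V. \<forall>y\<in>V. q (\<lambda>w. x w + y w) \<le> q x + q y) \<and>
     (\<forall>x\<in>V. \<forall>t>0. q (\<lambda>w. t * x w) = t * q x)"

definition linear_functional_on :: "('a \<Rightarrow> real) set \<Rightarrow> (('a \<Rightarrow> real) \<Rightarrow> real) \<Rightarrow> bool" where
  "linear_functional_on V p \<longleftrightarrow> (\<forall>x\<in>V. \<forall>y\<in>V. p (\<lambda>w. x w + y w) = p x + p y) \<and>
     (\<forall>x\<in>V. \<forall>t. p (\<lambda>w. t * x w) = t * p x)"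

lemma fun_subspace_add: "fun_subspace V \<Longrightarrow> x \<in> V \<Longrightarrow> y \<in> V \<Longrightarrow> (\<lambda>w. x w + y w) \<in> V"
  by (simp add: fun_subspace_def)

lemma fun_subspace_scale: "fun_subspace V \<Longrightarrow> x \<in> V \<Longrightarrow> (\<lambda>w. t * x w) \<in> V"
  by (simp add: fun_subspace_def)

lemma fun_subspace_uminus: "fun_subspace V \<Longrightarrow> x \<in> V \<Longrightarrow> (\<lambda>w. - x w) \<in> V"
  using fun_subspace_scale[of V x "-1"] by simp

lemma sublinear_on_add:
  "sublinear_on V q \<Longrightarrow> x \<in> V \<Longrightarrow> y \<in> V \<Longrightarrow> q (\<lambda>w. x w + y w) \<le> q x + q y"
  by (simp add: sublinear_on_def)

lemma sublinear_on_scale: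
  "sublinear_on V q \<Longrightarrow> x \<in> V \<Longrightarrow> t > 0 \<Longrightarrow> q (\<lambda>w. t * x w) = t * q x"
  by (simp add: sublinear_on_def)

lemma sublinear_on_zero:
  assumes "fun_subspace V" "sublinear_on V q"
  shows "q (\<lambda>_. 0) = 0"
proof -
  have "q (\<lambda>w. 2 * (\<lambda>_. 0) w) = 2 * q (\<lambda>_. 0)"
    using assms by (intro sublinear_on_scale) (auto simp: fun_subspace_def)
  then show ?thesis by simp
qed

text \<open>The lower bound involves \<open>q\<close> only through its value at \<open>-x\<close>. A
  common upper bound of a family of sublinear functionals therefore gives a common lower bound,
  which keeps pointwise infima finite.\<close>

lemma sublinear_on_uminus:
  assumes V: "fun_subspace V" and q: "sublinear_on V q" and x: "x \<in> V"
  shows "- q (\<lambda>w. - x w) \<le> q x"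
proof -
  have m: "(\<lambda>w. - x w) \<in> V"
    by (rule fun_subspace_uminus[OF V x])
  have "q (\<lambda>w. x w + - x w) \<le> q x + q (\<lambda>w. - x w)"
    by (rule sublinear_on_add[OF q x m])
  then show ?thesis using sublinear_on_zero[OF V q] by simp
qed

text \<open>The directional infimum below is again sublinear, so a minimal sublinear functional is
  linear.\<close>

lemma sublinear_on_direction:
  assumes V: "fun_subspace V" and q: "sublinear_on V q" and y: "y \<in> V"
  obtains r where "sublinear_on V r" "\<And>x. x \<in> V \<Longrightarrow> r x \<le> q x"
    "\<And>x. x \<in> V \<Longrightarrow> r x \<le> q (\<lambda>w. x w + y w) - q y"
proof -
  \<comment> \<open>\<open>g x t\<close> does not increase with \<open>t\<close>, by subadditivity.
    The value \<open>t = 0\<close> gives the bound by \<open>q\<close>, and \<open>t = 1\<close> the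
    bound that later forces additivity at \<open>y\<close>.\<close>
  define g where "g x t = q (\<lambda>w. x w + t * y w) - t * q y" for x t
  define r where "r x = (INF t\<in>{0..}. g x t)" for x
  have V1: "(\<lambda>w. x w + t * y w) \<in> V" if "x \<in> V" for x t
    by (intro fun_subspace_add[OF V] fun_subspace_scale[OF V] that y)
  have Vt: "(\<lambda>w. t * x w) \<in> V" if "x \<in> V" for x t
    by (rule fun_subspace_scale[OF V that])
  have Vm: "(\<lambda>w. - x w) \<in> V" if "x \<in> V" for x
    using Vt[OF that, of "-1"] by simp
  have hom: "q (\<lambda>w. t * x w) = t * q x" if "x \<in> V" "t \<ge> 0" for x t
    using that sublinear_on_zero[OF V q] sublinear_on_scale[OF q, of x t]
    by (cases "t = 0") auto
  have sub: "q (\<lambda>w. x w + x' w) \<le> q x + q x'" if "x \<in> V" "x' \<in> V" for x x'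
    by (rule sublinear_on_add[OF q that])
  have lb: "- q (\<lambda>w. - x w) \<le> g x t" if "x \<in> V" "t \<ge> 0" for x t
  proof -
    have "q (\<lambda>w. (x w + t * y w) + (- x w)) \<le> q (\<lambda>w. x w + t * y w) + q (\<lambda>w. - x w)"
      by (rule sub[OF V1[OF that(1)] Vm[OF that(1)]])
    then show ?thesis using hom[OF y that(2)] by (simp add: g_def)
  qed
  have bdd: "bdd_below (g x ` {0..})" if "x \<in> V" for x
    using lb[OF that] by (intro bdd_belowI2[where m="- q (\<lambda>w. - x w)"]) auto
  have le: "r x \<le> g x t" if "x \<in> V" "t \<ge> 0" for x t
    unfolding r_def by (rule cINF_lower[OF bdd[OF that(1)]]) (use that in auto)
  have ge: "m \<le> r x" if "\<And>t. t \<ge> 0 \<Longrightarrow> m \<le> g x t" for x m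
    unfolding r_def by (rule cINF_greatest) (use that in auto)
  have r_hom_le: "r (\<lambda>w. t * x w) \<le> t * r x" if x: "x \<in> V" and t: "t > 0" for x t
  proof -
    have "r (\<lambda>w. t * x w) / t \<le> r x"
    proof (rule ge)
      fix s :: real assume s: "s \<ge> 0"
      have "r (\<lambda>w. t * x w) \<le> g (\<lambda>w. t * x w) (t * s)"
        by (rule le[OF Vt[OF x]]) (use s t in auto)
      also have "\<dots> = t * g x s"
        using hom[OF V1[OF x, of s], of t] t by (simp add: g_def algebra_simps)
      finally show "r (\<lambda>w. t * x w) / t \<le> g x s" using t by (simp add: field_simps)
    qed
    then show ?thesis using t by (simp add: field_simps)
  qed
  have "sublinear_on V r"
    unfolding sublinear_on_def
  proof (intro conjI ballI allI impI)
    fix x x' assume x: "x \<in> V" "x' \<in> V"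
    have "r (\<lambda>w. x w + x' w) - g x t \<le> r x'" if t: "t \<ge> 0" for t
    proof (rule ge)
      fix s :: real assume s: "s \<ge> 0"
      have "(\<lambda>w. x w + x' w) \<in> V" using x by (rule fun_subspace_add[OF V])
      then have "r (\<lambda>w. x w + x' w) \<le> g (\<lambda>w. x w + x' w) (t + s)"
        using t s by (intro le) auto
      moreover have "q (\<lambda>w. (x w + t * y w) + (x' w + s * y w)) \<le>
        q (\<lambda>w. x w + t * y w) + q (\<lambda>w. x' w + s * y w)"
        by (rule sub[OF V1[OF x(1)] V1[OF x(2)]])
      ultimately show "r (\<lambda>w. x w + x' w) - g x t \<le> g x' s"
        by (simp add: g_def algebra_simps)
    qed
    then have "r (\<lambda>w. x w + x' w) - r x' \<le> r x" by (intro ge) (simp add: algebra_simps)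
    then show "r (\<lambda>w. x w + x' w) \<le> r x + r x'" by simp
  next
    fix x and t :: real assume x: "x \<in> V" and t: "t > 0"
    have "r (\<lambda>w. (1/t) * (t * x w)) \<le> (1/t) * r (\<lambda>w. t * x w)"
      by (rule r_hom_le[OF Vt[OF x]]) (use t in auto)
    then have "t * r x \<le> r (\<lambda>w. t * x w)" using t by (simp add: field_simps)
    then show "r (\<lambda>w. t * x w) = t * r x" using r_hom_le[OF x t] by simp
  qed
  moreover have "r x \<le> q x" if "x \<in> V" for x
    using le[OF that, of 0] by (simp add: g_def)
  moreover have "r x \<le> q (\<lambda>w. x w + y w) - q y" if "x \<in> V" for x
    using le[OF that, of 1] by (simp add: g_def)
  ultimately show thesis by (rule that)
qed

text \<open>Supplies the lower bounds for Zorn's lemma. An infimum of sublinear functionals need not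
  be subadditive; in a chain, however, a functional \<open>q\<close> used at \<open>x\<close> and a
  functional \<open>q'\<close> used at \<open>y\<close> can both be replaced by the smaller of the
  two. Finiteness comes from \<open>sublinear_on_uminus\<close> and the common bound
  \<open>s\<close>.\<close>

lemma sublinear_on_chain_Inf:
  assumes V: "fun_subspace V" and "C \<noteq> {}"
    and sub: "\<And>q. q \<in> C \<Longrightarrow> sublinear_on V q"
    and bound: "\<And>q x. q \<in> C \<Longrightarrow> x \<in> V \<Longrightarrow> q x \<le> s x"
    and chain: "\<And>q q'. q \<in> C \<Longrightarrow> q' \<in> C \<Longrightarrow> (\<forall>x\<in>V. q x \<le> q' x) \<or> (\<forall>x\<in>V. q' x \<le> q x)"
  shows "sublinear_on V (\<lambda>x. INF q\<in>C. q x)"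
    and "\<And>q x. q \<in> C \<Longrightarrow> x \<in> V \<Longrightarrow> (INF q\<in>C. q x) \<le> q x"
proof -
  define r where "r x = (INF q\<in>C. q x)" for x
  have Vt: "(\<lambda>w. t * x w) \<in> V" if "x \<in> V" for x t
    by (rule fun_subspace_scale[OF V that])
  have bdd: "bdd_below ((\<lambda>q. q x) ` C)" if x: "x \<in> V" for x
  proof (rule bdd_belowI2[where m="- s (\<lambda>w. - x w)"])
    fix q assume "q \<in> C"
    then show "- s (\<lambda>w. - x w) \<le> q x"
      using sublinear_on_uminus[OF V sub x] bound[of q "\<lambda>w. - x w"] Vt[OF x, of "-1"] by fastforce
  qed
  have le: "r x \<le> q x" if "q \<in> C" "x \<in> V" for q x
    unfolding r_def by (rule cINF_lower[OF bdd]) (use that in auto)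
  have ge: "m \<le> r x" if "\<And>q. q \<in> C \<Longrightarrow> m \<le> q x" for x m
    unfolding r_def by (rule cINF_greatest) (use that assms in auto)
  show "\<And>q x. q \<in> C \<Longrightarrow> x \<in> V \<Longrightarrow> (INF q\<in>C. q x) \<le> q x"
    using le unfolding r_def .
  have r_hom_le: "r (\<lambda>w. t * x w) \<le> t * r x" if x: "x \<in> V" and t: "t > 0" for x t
  proof -
    have "r (\<lambda>w. t * x w) / t \<le> r x"
    proof (rule ge)
      fix q assume q: "q \<in> C"
      have "r (\<lambda>w. t * x w) \<le> q (\<lambda>w. t * x w)" by (rule le[OF q Vt[OF x]])
      also have "\<dots> = t * q x" by (rule sublinear_on_scale[OF sub[OF q] x t])
      finally show "r (\<lambda>w. t * x w) / t \<le> q x" using t by (simp add: field_simps)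
    qed
    then show ?thesis using t by (simp add: field_simps)
  qed
  have "sublinear_on V r"
    unfolding sublinear_on_def
  proof (intro conjI ballI allI impI)
    fix x y assume x: "x \<in> V" "y \<in> V"
    have xy: "(\<lambda>w. x w + y w) \<in> V" using x by (rule fun_subspace_add[OF V])
    have "r (\<lambda>w. x w + y w) - q x \<le> r y" if q: "q \<in> C" for q
    proof (rule ge)
      fix q' assume q': "q' \<in> C"
      have "r (\<lambda>w. x w + y w) \<le> q x + q y" "r (\<lambda>w. x w + y w) \<le> q' x + q' y"
        using le[OF q xy] le[OF q' xy] sublinear_on_add[OF sub[OF q] x]
          sublinear_on_add[OF sub[OF q'] x] by linarith+
      then show "r (\<lambda>w. x w + y w) - q x \<le> q' y"
        using chain[OF q q'] x by fastforce
    qed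
    then have "r (\<lambda>w. x w + y w) - r y \<le> r x" by (intro ge) (simp add: algebra_simps)
    then show "r (\<lambda>w. x w + y w) \<le> r x + r y" by simp
  next
    fix x and t :: real assume x: "x \<in> V" and t: "t > 0"
    have "r (\<lambda>w. (1/t) * (t * x w)) \<le> (1/t) * r (\<lambda>w. t * x w)"
      by (rule r_hom_le[OF Vt[OF x]]) (use t in auto)
    then have "t * r x \<le> r (\<lambda>w. t * x w)" using t by (simp add: field_simps)
    then show "r (\<lambda>w. t * x w) = t * r x" using r_hom_le[OF x t] by simp
  qed
  then show "sublinear_on V (\<lambda>x. INF q\<in>C. q x)" unfolding r_def .
qed

lemma sublinear_on_cong:
  assumes "fun_subspace V" "\<And>x. x \<in> V \<Longrightarrow> q x = q' x" "sublinear_on V q"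
  shows "sublinear_on V q'"
  using assms unfolding sublinear_on_def fun_subspace_def by simp

text \<open>Hahn--Banach in the form without a functional to extend: everything to be separated is
  put into \<open>s\<close>. Zorn's lemma gives a minimal sublinear functional below
  \<open>s\<close>; comparing it with the functionals of \<open>sublinear_on_direction\<close> shows
  that it is additive, and additivity extends homogeneity to negative factors.\<close>

lemma linear_functional_below_sublinear:
  assumes V: "fun_subspace V" and s: "sublinear_on V s"
  shows "\<exists>p. linear_functional_on V p \<and> (\<forall>x\<in>V. p x \<le> s x)"
proof -
  \<comment> \<open>Functionals are normalised to vanish off \<open>V\<close>, so that the order is antisymmetric.\<close>
  define cut where "cut q = (\<lambda>x. if x \<in> V then q x else 0)" for q :: "('a \<Rightarrow> real) \<Rightarrow> real"
  define A where "A = {q. sublinear_on V q \<and> (\<forall>x\<in>V. q x \<le> s x) \<and> cut q = q}"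
  \<comment> \<open>The pointwise order reversed: an element maximal for \<open>P\<close> is a
    minimal functional.\<close>
  define P where "P q r \<longleftrightarrow> (r::('a \<Rightarrow> real) \<Rightarrow> real) \<le> q" for q r
  have cutA: "cut q \<in> A" if "sublinear_on V q" "\<And>x. x \<in> V \<Longrightarrow> q x \<le> s x" for q
    using that sublinear_on_cong[OF V, of q "cut q"] by (auto simp: A_def cut_def)
  have "\<exists>m\<in>A. \<forall>a\<in>A. P m a \<longrightarrow> a = m"
  proof (rule predicate_Zorn)
    show "partial_order_on A (relation_of P A)"
      by (auto simp: partial_order_on_def preorder_on_def refl_on_def trans_def antisym_def
          relation_of_def P_def)
  next
    fix C assume C: "C \<in> Chains (relation_of P A)"
    then have CA: "C \<subseteq> A" and tot: "\<And>q r. q \<in> C \<Longrightarrow> r \<in> C \<Longrightarrow> r \<le> q \<or> q \<le> r"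
      by (auto simp: Chains_def relation_of_def P_def)
    show "\<exists>u\<in>A. \<forall>a\<in>C. P a u"
    proof (cases "C = {}")
      case True
      then show ?thesis using cutA[OF s] by auto
    next
      case False
      have sub: "sublinear_on V q" and le: "x \<in> V \<Longrightarrow> q x \<le> s x" if "q \<in> C" for q x
        using that CA by (auto simp: A_def)
      have chain: "(\<forall>x\<in>V. q x \<le> r x) \<or> (\<forall>x\<in>V. r x \<le> q x)" if "q \<in> C" "r \<in> C" for q r
        using tot[OF that] by (auto simp: le_fun_def)
      have *: "sublinear_on V (\<lambda>x. INF q\<in>C. q x)"
        by (rule sublinear_on_chain_Inf(1)[where s=s, OF V False])
          (erule sub, erule (1) le, erule (1) chain)
      have **: "(INF q\<in>C. q x) \<le> q x" if "q \<in> C" "x \<in> V" for q x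
        by (rule sublinear_on_chain_Inf(2)[where s=s, OF V False _ _ _ that])
          (erule sub, erule (1) le, erule (1) chain)
      obtain q0 where q0: "q0 \<in> C" using False by auto
      have "cut (\<lambda>x. INF q\<in>C. q x) \<in> A"
        using **[OF q0] le[OF q0] by (intro cutA *) (meson order_trans)
      moreover have "cut (\<lambda>x. INF q\<in>C. q x) \<le> q" if "q \<in> C" for q
      proof -
        have "cut q = q" using that CA by (auto simp: A_def)
        then have "q x = 0" if "x \<notin> V" for x using that by (metis cut_def)
        then show ?thesis using **[OF that] by (auto simp: le_fun_def cut_def)
      qed
      ultimately show ?thesis unfolding P_def by blast
    qed
  qed
  then obtain p where p: "p \<in> A" and min: "\<And>q. q \<in> A \<Longrightarrow> q \<le> p \<Longrightarrow> q = p"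
    unfolding P_def by blast
  have sub: "sublinear_on V p" and ps: "\<And>x. x \<in> V \<Longrightarrow> p x \<le> s x" and cp: "cut p = p"
    using p by (auto simp: A_def)
  have add: "p (\<lambda>w. x w + y w) = p x + p y" if x: "x \<in> V" and y: "y \<in> V" for x y
  proof -
    obtain r where r: "sublinear_on V r" "\<And>x. x \<in> V \<Longrightarrow> r x \<le> p x"
      "\<And>x. x \<in> V \<Longrightarrow> r x \<le> p (\<lambda>w. x w + y w) - p y"
      using sublinear_on_direction[OF V sub y] by blast
    have "cut r \<in> A" using r(2) ps by (intro cutA r(1)) (meson order_trans)
    moreover have "cut r \<le> p"
      by (subst cp[symmetric]) (use r(2) in \<open>auto simp: cut_def le_fun_def\<close>)
    ultimately have "cut r = p" by (rule min)
    \<comment> \<open>Once \<open>r\<close> agrees with \<open>p\<close>, its third property becomes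
      superadditivity of \<open>p\<close> at \<open>y\<close>.\<close>
    then have "r x = p x" using x by (metis cut_def)
    then have "p x + p y \<le> p (\<lambda>w. x w + y w)" using r(3)[OF x] by simp
    then show ?thesis using sublinear_on_add[OF sub x y] by simp
  qed
  have zero: "p (\<lambda>_. 0) = 0" by (rule sublinear_on_zero[OF V sub])
  have Vt: "(\<lambda>w. t * x w) \<in> V" if "x \<in> V" for x t
    by (rule fun_subspace_scale[OF V that])
  have pos: "p (\<lambda>w. t * x w) = t * p x" if "x \<in> V" "t > 0" for x t
    by (rule sublinear_on_scale[OF sub that])
  have "p (\<lambda>w. t * x w) = t * p x" if x: "x \<in> V" for x t
  proof (cases t "0::real" rule: linorder_cases)
    case less
    have "p (\<lambda>w. t * x w + (- t) * x w) = p (\<lambda>w. t * x w) + p (\<lambda>w. (- t) * x w)"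
      by (rule add[OF Vt[OF x] Vt[OF x]])
    then show ?thesis using pos[OF x, of "-t"] less zero by simp
  qed (use zero pos[OF x] in auto)
  then have "linear_functional_on V p"
    unfolding linear_functional_on_def using add by blast
  then show ?thesis using ps by (intro exI[of _ p]) auto
qed

section \<open>Continuity of convex expectations\<close>

lemma convex_expectation_mono:
  assumes "convex_expectation M \<rho>" "integrable M X" "integrable M Y" "AE x in M. X x \<le> Y x"
  shows "\<rho> X \<le> \<rho> Y"
  using assms by (simp add: convex_expectation_def)

lemma convex_expectation_cong_AE:
  assumes "convex_expectation M \<rho>" "integrable M X" "integrable M Y" "AE x in M. X x = Y x"
  shows "\<rho> X = \<rho> Y"
  using assms by (intro order_antisym convex_expectation_mono[OF assms(1)]) auto

lemma convex_expectation_translate: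
  "convex_expectation M \<rho> \<Longrightarrow> integrable M X \<Longrightarrow> \<rho> (\<lambda>x. X x + c) = \<rho> X + c"
  by (simp add: convex_expectation_def)

lemma convex_expectation_convex:
  "convex_expectation M \<rho> \<Longrightarrow> integrable M X \<Longrightarrow> integrable M Y \<Longrightarrow> 0 \<le> l \<Longrightarrow> l \<le> 1 \<Longrightarrow>
    \<rho> (\<lambda>x. l * X x + (1 - l) * Y x) \<le> l * \<rho> X + (1 - l) * \<rho> Y"
  by (simp add: convex_expectation_def)

text \<open>By monotone convergence the integral of the sum is finite, so the sum is finite almost
  everywhere.\<close>

lemma AE_summable_if_summable_integral:
  fixes f :: "nat \<Rightarrow> 'a \<Rightarrow> real"
  assumes f: "\<And>n. integrable M (f n)" and nonneg: "\<And>n x. f n x \<ge> 0"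
    and sum: "summable (\<lambda>n. \<integral>x. f n x \<partial>M)"
  shows "AE x in M. summable (\<lambda>n. f n x)"
proof -
  have [measurable]: "f n \<in> borel_measurable M" for n using f by auto
  have "(\<integral>\<^sup>+x. (\<Sum>n. ennreal (f n x)) \<partial>M) = (\<Sum>n. \<integral>\<^sup>+x. ennreal (f n x) \<partial>M)"
    by (rule nn_integral_suminf) simp
  also have "\<dots> = (\<Sum>n. ennreal (\<integral>x. f n x \<partial>M))"
    using f nonneg by (simp add: nn_integral_eq_integral)
  also have "\<dots> \<noteq> \<infinity>"
    using sum nonneg by (simp add: ennreal_suminf_neq_top)
  finally have "AE x in M. (\<Sum>n. ennreal (f n x)) \<noteq> \<infinity>"
    by (intro nn_integral_PInf_AE) auto
  then show ?thesis
    using nonneg by (auto elim!: eventually_mono intro: summable_suminf_not_top)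
qed

text \<open>A sequence converging fast in \<open>L\<^sup>1\<close> is dominated, up to a factor \<open>2\<^sup>-\<^sup>k\<close>, by a single
  integrable function \<open>Z\<close>; monotonicity and convexity along the segments from \<open>X\<close> to
  \<open>X \<plusminus> Z\<close> then control the functional.\<close>

lemma convex_expectation_continuous:
  assumes \<rho>: "convex_expectation M \<rho>" and X: "integrable M X" and e: "e > 0"
  shows "\<exists>d>0. \<forall>Y. integrable M Y \<longrightarrow> (\<integral>x. \<bar>Y x - X x\<bar> \<partial>M) < d \<longrightarrow> \<bar>\<rho> Y - \<rho> X\<bar> < e"
proof (rule ccontr)
  assume neg: "\<not> ?thesis"
  have no: "\<exists>Y. integrable M Y \<and> (\<integral>x. \<bar>Y x - X x\<bar> \<partial>M) < d \<and> \<bar>\<rho> Y - \<rho> X\<bar> \<ge> e"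
    if "d > 0" for d using neg that by (meson not_less)
  obtain Y where Y: "\<And>k. integrable M (Y k)"
    and Yd: "\<And>k. (\<integral>x. \<bar>Y k x - X x\<bar> \<partial>M) < (1/4)^k"
    and Ye: "\<And>k. \<bar>\<rho> (Y k) - \<rho> X\<bar> \<ge> e"
    using no[of "(1/4)^k" for k] choice[of "\<lambda>k Y. integrable M Y \<and> (\<integral>x. \<bar>Y x - X x\<bar> \<partial>M) < (1/4)^k \<and> \<bar>\<rho> Y - \<rho> X\<bar> \<ge> e"]
    by auto
  \<comment> \<open>The rate \<open>(1/4)^k\<close> leaves room for the weights \<open>2^k\<close>:
    the weighted differences still have summable norms, at most \<open>(1/2)^k\<close>, and dividing
    by the weight gives the factor \<open>(1/2)^k\<close> in \<open>dom\<close>.\<close>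
  define f where "f k x = 2^k * \<bar>Y k x - X x\<bar>" for k :: nat and x
  define Z where "Z x = (\<Sum>k. f k x)" for x
  have f: "integrable M (f k)" for k unfolding f_def using X Y by simp
  have f0: "f k x \<ge> 0" for k x by (simp add: f_def)
  have fI: "(\<integral>x. f k x \<partial>M) \<le> (1/2)^k" for k
  proof -
    have "(\<integral>x. f k x \<partial>M) = 2^k * (\<integral>x. \<bar>Y k x - X x\<bar> \<partial>M)" by (simp add: f_def)
    also have "\<dots> \<le> 2^k * (1/4)^k" using Yd[of k] by simp
    also have "\<dots> = (1/2)^k" by (simp flip: power_mult_distrib)
    finally show ?thesis .
  qed
  have sI: "summable (\<lambda>k. \<integral>x. f k x \<partial>M)"
    by (rule summable_comparison_test'[of "\<lambda>k. (1/2)^k"]) (use fI f0 in auto)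
  have sAE: "AE x in M. summable (\<lambda>k. f k x)"
    by (rule AE_summable_if_summable_integral[OF f f0 sI])
  have Z: "integrable M Z"
    unfolding Z_def by (rule integrable_suminf) (use f sAE sI f0 in auto)
  have dom: "AE x in M. \<bar>Y k x - X x\<bar> \<le> (1/2)^k * Z x" for k
    using sAE
  proof eventually_elim
    case (elim x)
    have "f k x \<le> Z x"
      unfolding Z_def using sum_le_suminf[OF elim, of "{k}"] f0 by simp
    then have "(1/2)^k * f k x \<le> (1/2)^k * Z x" by (intro mult_left_mono) auto
    moreover have "(1/2)^k * f k x = \<bar>Y k x - X x\<bar>"
      by (simp add: f_def power_one_over)
    ultimately show ?case by simp
  qed
  define D where "D = \<rho> (\<lambda>x. X x + Z x) - \<rho> X"
  have XZ: "integrable M (\<lambda>x. X x + t * Z x)" for t using X Z by simp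
  have up: "\<rho> (\<lambda>x. X x + t * Z x) \<le> \<rho> X + t * D" if "0 \<le> t" "t \<le> 1" for t
  proof -
    have "(\<lambda>x. X x + t * Z x) = (\<lambda>x. t * (X x + Z x) + (1 - t) * X x)"
      by (auto simp: algebra_simps)
    then show ?thesis
      using convex_expectation_convex[OF \<rho> XZ[of 1] X that] by (simp add: D_def algebra_simps)
  qed
  have lo: "\<rho> (\<lambda>x. X x + (- t) * Z x) \<ge> \<rho> X - t * D" if t: "0 \<le> t" for t
  proof -
    \<comment> \<open>The weight for which \<open>X\<close> is the convex combination of
      \<open>X - t Z\<close> and \<open>X + Z\<close>; convexity at \<open>X\<close> then bounds
      \<open>\<rho> (X - t Z)\<close> from below.\<close>
    define l where "l = 1 / (1 + t)"
    have l: "0 \<le> l" "l \<le> 1" using t by (auto simp: l_def)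
    have l2: "1 - l = t * l" and l3: "l * (1 + t) = 1" using t by (auto simp: l_def field_simps)
    have "l * (X x + (- t) * Z x) + (1 - l) * (X x + Z x) = X x" for x
    proof -
      have "l * (X x + (- t) * Z x) + (1 - l) * (X x + Z x) = (l * (1 + t)) * X x"
        unfolding l2 by (simp add: algebra_simps)
      then show ?thesis by (simp add: l3)
    qed
    then have "\<rho> X \<le> l * \<rho> (\<lambda>x. X x + (- t) * Z x) + (1 - l) * \<rho> (\<lambda>x. X x + Z x)"
      using convex_expectation_convex[OF \<rho> XZ[of "-t"] XZ[of 1] l] by simp
    then have "(1 + t) * \<rho> X \<le> (1 + t) * (l * \<rho> (\<lambda>x. X x + (- t) * Z x) + (1 - l) * \<rho> (\<lambda>x. X x + Z x))"
      using t by (intro mult_left_mono) auto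
    also have "\<dots> = (l * (1 + t)) * (\<rho> (\<lambda>x. X x + (- t) * Z x) + t * \<rho> (\<lambda>x. X x + Z x))"
      unfolding l2 by (simp add: algebra_simps)
    finally show ?thesis unfolding l3 D_def by (simp add: algebra_simps)
  qed
  have "e \<le> (1/2)^k * D" for k :: nat
  proof -
    have t: "0 \<le> (1/2::real)^k" "(1/2::real)^k \<le> 1" by (auto simp: power_le_one)
    have "\<rho> (Y k) \<le> \<rho> (\<lambda>x. X x + (1/2)^k * Z x)"
      by (rule convex_expectation_mono[OF \<rho> Y XZ]) (use dom[of k] in \<open>auto elim!: eventually_mono\<close>)
    moreover have "\<rho> (\<lambda>x. X x + (- ((1/2)^k)) * Z x) \<le> \<rho> (Y k)"
      by (rule convex_expectation_mono[OF \<rho> XZ Y]) (use dom[of k] in \<open>auto elim!: eventually_mono\<close>)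
    ultimately have "\<bar>\<rho> (Y k) - \<rho> X\<bar> \<le> (1/2)^k * D" using up[OF t] lo[OF t(1)] by linarith
    then show ?thesis using Ye[of k] by linarith
  qed
  moreover have "(\<lambda>k. (1/2)^k * D) \<longlonglongrightarrow> 0 * D"
    by (intro tendsto_mult LIMSEQ_realpow_zero tendsto_const) auto
  ultimately have "e \<le> 0 * D" by (intro LIMSEQ_le_const) auto
  then show False using e by simp
qed

lemma convex_expectation_tendsto:
  assumes \<rho>: "convex_expectation M \<rho>" and X: "integrable M X" and Y: "\<And>n. integrable M (Y n)"
    and lim: "(\<lambda>n. \<integral>x. \<bar>Y n x - X x\<bar> \<partial>M) \<longlonglongrightarrow> 0"
  shows "(\<lambda>n. \<rho> (Y n)) \<longlonglongrightarrow> \<rho> X"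
proof (rule tendstoI)
  fix e :: real assume "e > 0"
  then obtain d where d: "d > 0"
    "\<And>Y. integrable M Y \<Longrightarrow> (\<integral>x. \<bar>Y x - X x\<bar> \<partial>M) < d \<Longrightarrow> \<bar>\<rho> Y - \<rho> X\<bar> < e"
    using convex_expectation_continuous[OF \<rho> X] by blast
  show "\<forall>\<^sub>F n in sequentially. dist (\<rho> (Y n)) (\<rho> X) < e"
    using order_tendstoD(2)[OF lim d(1)] by eventually_elim (simp add: dist_real_def d(2)[OF Y])
qed

text \<open>Domination turns almost everywhere convergence into convergence in L1, where the
  functional is continuous.\<close>

lemma convex_expectation_dominated_tendsto:
  assumes \<rho>: "convex_expectation M \<rho>"
    and X: "X \<in> borel_measurable M" and Y: "\<And>n. Y n \<in> borel_measurable M"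
    and W: "integrable M W" and bound: "\<And>n. AE x in M. \<bar>Y n x\<bar> \<le> W x"
    and lim: "AE x in M. (\<lambda>n. Y n x) \<longlonglongrightarrow> X x"
  shows "(\<lambda>n. \<rho> (Y n)) \<longlonglongrightarrow> \<rho> X"
proof (rule convex_expectation_tendsto[OF \<rho>])
  have 1: "integrable M X"
    by (rule integrable_dominated_convergence[OF X Y W lim]) (use bound in auto)
  show "integrable M X" by fact
  show 2: "integrable M (Y n)" for n
    by (rule integrable_dominated_convergence2[OF X Y W lim]) (use bound in auto)
  have "(\<lambda>n. \<integral>x. \<bar>Y n x - X x\<bar> \<partial>M) \<longlonglongrightarrow> (\<integral>x. 0 \<partial>M)"
  proof (rule integral_dominated_convergence[where w="\<lambda>x. W x + \<bar>X x\<bar>"])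
    show "AE x in M. (\<lambda>n. \<bar>Y n x - X x\<bar>) \<longlonglongrightarrow> 0"
      using lim by eventually_elim (auto intro!: tendsto_eq_intros)
    show "AE x in M. norm \<bar>Y n x - X x\<bar> \<le> W x + \<bar>X x\<bar>" for n
      using bound[of n] by eventually_elim auto
  qed (use 1 2 W X Y in auto)
  then show "(\<lambda>n. \<integral>x. \<bar>Y n x - X x\<bar> \<partial>M) \<longlonglongrightarrow> 0" by simp
qed

section \<open>Affine minorants\<close>

lemma linear_functional_onD:
  assumes "linear_functional_on V p" "X \<in> V"
  shows "Y \<in> V \<Longrightarrow> p (\<lambda>w. X w + Y w) = p X + p Y" "p (\<lambda>w. t * X w) = t * p X"
  using assms by (simp_all add: linear_functional_on_def)

lemma fun_subspace_integrable: "fun_subspace {X :: 'a \<Rightarrow> real. integrable M X}"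
  by (simp add: fun_subspace_def)

text \<open>A Hahn--Banach sandwich: the positively homogeneous hull \<open>s\<close> of
  \<open>U \<mapsto> inf {\<rho> (Y + U) + r | (Y, r) \<in> S}\<close> is finite and sublinear, and a linear functional
  below \<open>s\<close> separates \<open>\<rho>\<close> from \<open>S\<close>.\<close>

lemma convex_expectation_sandwich:
  assumes \<rho>: "convex_expectation M \<rho>" and "S \<noteq> {}"
    and int: "\<And>Y r. (Y, r) \<in> S \<Longrightarrow> integrable M Y"
    and conv: "\<And>Y r Y' r' l. (Y, r) \<in> S \<Longrightarrow> (Y', r') \<in> S \<Longrightarrow> 0 \<le> l \<Longrightarrow> l \<le> 1 \<Longrightarrow>
      ((\<lambda>x. l * Y x + (1 - l) * Y' x), l * r + (1 - l) * r') \<in> S"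
    and nonneg: "\<And>Y r. (Y, r) \<in> S \<Longrightarrow> 0 \<le> \<rho> Y + r"
  shows "\<exists>p c. linear_functional_on {X. integrable M X} p \<and>
    (\<forall>W. integrable M W \<longrightarrow> p W - c \<le> \<rho> W) \<and> (\<forall>(Y, r)\<in>S. 0 \<le> p Y - c + r)"
proof -
  \<comment> \<open>\<open>h\<close> is the perspective of the convex map
    \<open>U \<mapsto> \<rho> (Y + U) + r\<close>: the free scale \<open>t\<close> makes the infimum
    positively homogeneous, and convexity of \<open>\<rho>\<close> and of \<open>S\<close> makes it
    subadditive.\<close>
  define I where "I = {0::real<..} \<times> S"
  define h where "h U i = (case i of (t, Y, r) \<Rightarrow> t * (\<rho> (\<lambda>x. Y x + U x / t) + r))"
    for U and i :: "real \<times> ('a \<Rightarrow> real) \<times> real"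
  define s where "s U = (INF i\<in>I. h U i)" for U
  obtain Y0 r0 where Y0: "(Y0, r0) \<in> S" using \<open>S \<noteq> {}\<close> by auto
  then have "I \<noteq> {}" by (auto simp: I_def intro: gt_ex)
  have h_add: "\<exists>k\<in>I. h (\<lambda>x. U x + U' x) k \<le> h U i + h U' j"
    if U: "integrable M U" "integrable M U'" and ij: "i \<in> I" "j \<in> I" for U U' i j
  proof -
    obtain t Y r where i: "i = (t, Y, r)" "t > 0" "(Y, r) \<in> S" using ij by (auto simp: I_def)
    obtain t' Y' r' where j: "j = (t', Y', r')" "t' > 0" "(Y', r') \<in> S"
      using ij by (auto simp: I_def)
    \<comment> \<open>Scales add under the perspective: the new index has scale
      \<open>t + t'\<close> and mixes the two pairs in proportion to the old scales.\<close>
    define l where "l = t / (t + t')"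
    have l: "0 \<le> l" "l \<le> 1" using i j by (auto simp: l_def)
    have l2: "1 - l = t' / (t + t')" using i j by (simp add: l_def diff_divide_eq_iff)
    have lt: "l * (t + t') = t" "(1 - l) * (t + t') = t'" "l / t = 1 / (t + t')"
      "(1 - l) / t' = 1 / (t + t')"
      using i j l2 by (simp_all add: l_def)
    define Z where "Z = (\<lambda>x. l * Y x + (1 - l) * Y' x)"
    define q where "q = l * r + (1 - l) * r'"
    have k: "(t + t', Z, q) \<in> I"
      using conv[OF i(3) j(3) l] i j by (auto simp: I_def Z_def q_def)
    have "Z x + (U x + U' x) / (t + t') =
        l * (Y x + U x / t) + (1 - l) * (Y' x + U' x / t')" for x
    proof -
      have "l * (Y x + U x / t) + (1 - l) * (Y' x + U' x / t') =
        Z x + (l / t) * U x + ((1 - l) / t') * U' x" by (simp add: Z_def algebra_simps)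
      then show ?thesis by (simp add: lt add_divide_distrib)
    qed
    then have "\<rho> (\<lambda>x. Z x + (U x + U' x) / (t + t')) \<le>
        l * \<rho> (\<lambda>x. Y x + U x / t) + (1 - l) * \<rho> (\<lambda>x. Y' x + U' x / t')"
      using convex_expectation_convex[OF \<rho>, of "\<lambda>x. Y x + U x / t" "\<lambda>x. Y' x + U' x / t'" l]
        U int i j l by simp
    then have "(t + t') * (\<rho> (\<lambda>x. Z x + (U x + U' x) / (t + t')) + q) \<le>
      (t + t') * (l * \<rho> (\<lambda>x. Y x + U x / t) + (1 - l) * \<rho> (\<lambda>x. Y' x + U' x / t') + q)"
      using i j by (intro mult_left_mono) auto
    also have "\<dots> = (l * (t + t')) * (\<rho> (\<lambda>x. Y x + U x / t) + r)
        + ((1 - l) * (t + t')) * (\<rho> (\<lambda>x. Y' x + U' x / t') + r')"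
      by (simp add: q_def algebra_simps)
    finally have "h (\<lambda>x. U x + U' x) (t + t', Z, q) \<le> h U i + h U' j"
      unfolding lt by (simp add: h_def i j)
    then show ?thesis using k by blast
  qed
  \<comment> \<open>This is where the hypothesis on \<open>S\<close> enters. Adding a value at
    \<open>U\<close> and one at \<open>-U\<close> dominates some value at zero, so
    \<open>h U\<close> is bounded below.\<close>
  have h0: "0 \<le> h (\<lambda>_. 0) i" if "i \<in> I" for i
    using that nonneg by (auto simp: I_def h_def)
  have bdd: "bdd_below (h U ` I)" if U: "integrable M U" for U
  proof (rule bdd_belowI2[where m="- h (\<lambda>x. - U x) (1, Y0, r0)"])
    fix i assume i: "i \<in> I"
    have "(1, Y0, r0) \<in> I" using Y0 by (simp add: I_def)
    then obtain k where "k \<in> I" "h (\<lambda>x. U x + - U x) k \<le> h U i + h (\<lambda>x. - U x) (1, Y0, r0)"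
      using h_add[OF U, of "\<lambda>x. - U x" i "(1, Y0, r0)"] U i by auto
    then show "- h (\<lambda>x. - U x) (1, Y0, r0) \<le> h U i" using h0[of k] by simp
  qed
  have s_le: "s U \<le> h U i" if "integrable M U" "i \<in> I" for U i
    unfolding s_def by (rule cINF_lower[OF bdd]) (use that in auto)
  have s_ge: "m \<le> s U" if "\<And>i. i \<in> I \<Longrightarrow> m \<le> h U i" for U m
    unfolding s_def by (rule cINF_greatest) (use that \<open>I \<noteq> {}\<close> in auto)
  have s_hom_le: "s (\<lambda>x. t * U x) \<le> t * s U" if U: "integrable M U" and t: "t > 0" for U t
  proof -
    have "s (\<lambda>x. t * U x) / t \<le> s U"
    proof (rule s_ge)
      fix i assume "i \<in> I"
      then obtain u Y r where i: "i = (u, Y, r)" "u > 0" "(Y, r) \<in> S" by (auto simp: I_def)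
      have "s (\<lambda>x. t * U x) \<le> h (\<lambda>x. t * U x) (t * u, Y, r)"
        by (rule s_le) (use i U t in \<open>auto simp: I_def\<close>)
      also have "\<dots> = t * h U i" using i t by (simp add: h_def)
      finally show "s (\<lambda>x. t * U x) / t \<le> h U i" using t by (simp add: field_simps)
    qed
    then show ?thesis using t by (simp add: field_simps)
  qed
  have "sublinear_on {X. integrable M X} s"
    unfolding sublinear_on_def mem_Collect_eq Ball_def
  proof (intro conjI allI impI)
    fix U U' :: "'a \<Rightarrow> real" assume U: "integrable M U" "integrable M U'"
    have "s (\<lambda>x. U x + U' x) - h U i \<le> s U'" if i: "i \<in> I" for i
    proof (rule s_ge)
      fix j assume "j \<in> I"
      then obtain k where "k \<in> I" "h (\<lambda>x. U x + U' x) k \<le> h U i + h U' j"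
        using h_add[OF U i] by blast
      then show "s (\<lambda>x. U x + U' x) - h U i \<le> h U' j"
        using s_le[of "\<lambda>x. U x + U' x" k] U by simp
    qed
    then have "s (\<lambda>x. U x + U' x) - s U' \<le> s U" by (intro s_ge) (simp add: algebra_simps)
    then show "s (\<lambda>x. U x + U' x) \<le> s U + s U'" by simp
  next
    fix U :: "'a \<Rightarrow> real" and t :: real assume U: "integrable M U" and t: "t > 0"
    have "s (\<lambda>x. (1/t) * (t * U x)) \<le> (1/t) * s (\<lambda>x. t * U x)"
      by (rule s_hom_le) (use t U in auto)
    then have "t * s U \<le> s (\<lambda>x. t * U x)" using t by (simp add: field_simps)
    then show "s (\<lambda>x. t * U x) = t * s U" using s_hom_le[OF U t] by simp
  qed
  then obtain p where p: "linear_functional_on {X. integrable M X} p"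
    and ps: "\<And>U. integrable M U \<Longrightarrow> p U \<le> s U"
    using linear_functional_below_sublinear[OF fun_subspace_integrable] by force
  have bound: "p W - \<rho> W \<le> p Y + r" if W: "integrable M W" and Y: "(Y, r) \<in> S" for W Y r
  proof -
    have Yi: "integrable M Y" by (rule int[OF Y])
    \<comment> \<open>At \<open>U = W - Y\<close> with scale one the function \<open>Y + U\<close>
      is \<open>W\<close>, so \<open>p \<le> s\<close> reads
      \<open>p W - p Y \<le> \<rho> W + r\<close>.\<close>
    have "p (\<lambda>x. W x - Y x) \<le> h (\<lambda>x. W x - Y x) (1, Y, r)"
      using ps[of "\<lambda>x. W x - Y x"] s_le[of "\<lambda>x. W x - Y x" "(1, Y, r)"] W Yi Y
      by (simp add: I_def)
    moreover have "p (\<lambda>x. (W x - Y x) + Y x) = p (\<lambda>x. W x - Y x) + p Y"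
      using W Yi by (intro linear_functional_onD[OF p]) auto
    ultimately show ?thesis by (simp add: h_def)
  qed
  \<comment> \<open>The conjugate of \<open>\<rho>\<close> at \<open>p\<close>. In
    \<open>bound\<close> the left side depends only on \<open>W\<close> and the right side only on
    the pair in \<open>S\<close>, so this supremum is finite and separates the two.\<close>
  define c where "c = (SUP W\<in>{W. integrable M W}. p W - \<rho> W)"
  have "bdd_above ((\<lambda>W. p W - \<rho> W) ` {W. integrable M W})"
    using bound[OF _ Y0] by (intro bdd_aboveI2) auto
  then have "p W - \<rho> W \<le> c" if "integrable M W" for W
    unfolding c_def using that by (intro cSUP_upper) auto
  moreover have "c \<le> p Y + r" if "(Y, r) \<in> S" for Y r
    unfolding c_def using bound[OF _ that]
    by (intro cSUP_least) (auto intro: exI[of _ "\<lambda>_. 0"])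
  ultimately have "(\<forall>W. integrable M W \<longrightarrow> p W - c \<le> \<rho> W) \<and> (\<forall>(Y, r)\<in>S. 0 \<le> p Y - c + r)"
    by (auto simp: algebra_simps)
  then show ?thesis using p by (intro exI[of _ p] exI[of _ c] conjI) auto
qed

text \<open>With weight zero the inequality on \<open>S\<close> no longer sees the functional, but a
  minorant must still exist, since a measure is later built from it; a sandwich against the single
  pair \<open>(0, - \<rho> 0)\<close> supplies one. For positive weight the offsets are divided by
  \<open>a\<close>.\<close>

lemma convex_expectation_weighted_sandwich:
  assumes \<rho>: "convex_expectation M \<rho>" and "S \<noteq> {}"
    and int: "\<And>Y r. (Y, r) \<in> S \<Longrightarrow> integrable M Y"
    and conv: "\<And>Y r Y' r' l. (Y, r) \<in> S \<Longrightarrow> (Y', r') \<in> S \<Longrightarrow> 0 \<le> l \<Longrightarrow> l \<le> 1 \<Longrightarrow>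
      ((\<lambda>x. l * Y x + (1 - l) * Y' x), l * r + (1 - l) * r') \<in> S"
    and a: "0 \<le> a"
    and nonneg: "\<And>Y r. (Y, r) \<in> S \<Longrightarrow> 0 \<le> a * \<rho> Y + r"
  shows "\<exists>p c. linear_functional_on {X. integrable M X} p \<and>
    (\<forall>W. integrable M W \<longrightarrow> p W - c \<le> \<rho> W) \<and> (\<forall>(Y, r)\<in>S. 0 \<le> a * (p Y - c) + r)"
proof (cases "a = 0")
  case True
  have "\<exists>p c. linear_functional_on {X. integrable M X} p \<and>
    (\<forall>W. integrable M W \<longrightarrow> p W - c \<le> \<rho> W) \<and>
    (\<forall>(Y, r)\<in>{((\<lambda>_. 0), - \<rho> (\<lambda>_. 0))}. 0 \<le> p Y - c + r)"
    by (rule convex_expectation_sandwich[OF \<rho>]) (auto simp: algebra_simps)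
  then obtain p c where "linear_functional_on {X. integrable M X} p"
    "\<forall>W. integrable M W \<longrightarrow> p W - c \<le> \<rho> W" by (elim exE conjE)
  then show ?thesis using True nonneg by (intro exI[of _ p] exI[of _ c] conjI) auto
next
  case False
  then have a: "a > 0" using a by simp
  define T where "T = (\<lambda>(Y, r). (Y, r / a)) ` S"
  have T: "(Y, q) \<in> T \<longleftrightarrow> (Y, a * q) \<in> S" for Y q
    using a unfolding T_def by (force simp: image_iff)
  have "\<exists>p c. linear_functional_on {X. integrable M X} p \<and>
    (\<forall>W. integrable M W \<longrightarrow> p W - c \<le> \<rho> W) \<and> (\<forall>(Y, r)\<in>T. 0 \<le> p Y - c + r)"
  proof (rule convex_expectation_sandwich[OF \<rho>])
    show "T \<noteq> {}" using \<open>S \<noteq> {}\<close> by (simp add: T_def)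
    show "integrable M Y" if "(Y, r) \<in> T" for Y r using that int by (auto simp: T)
    show "((\<lambda>x. l * Y x + (1 - l) * Y' x), l * r + (1 - l) * r') \<in> T"
      if "(Y, r) \<in> T" "(Y', r') \<in> T" "0 \<le> l" "l \<le> 1" for Y r Y' r' l
      using conv[of Y "a * r" Y' "a * r'" l] that by (simp add: T algebra_simps)
    show "0 \<le> \<rho> Y + r" if "(Y, r) \<in> T" for Y r
    proof -
      have "0 \<le> a * (\<rho> Y + r)" using nonneg[of Y "a * r"] that by (simp add: T algebra_simps)
      then show ?thesis using a by (simp add: zero_le_mult_iff)
    qed
  qed
  then obtain p c where pc: "linear_functional_on {X. integrable M X} p"
    "\<forall>W. integrable M W \<longrightarrow> p W - c \<le> \<rho> W" "\<forall>(Y, r)\<in>T. 0 \<le> p Y - c + r"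
    by (elim exE conjE)
  have "0 \<le> a * (p Y - c) + r" if "(Y, r) \<in> S" for Y r
  proof -
    have "(Y, r / a) \<in> T" using that a by (simp add: T)
    then have "0 \<le> a * (p Y - c + r / a)" using pc(3) a by (auto intro!: mult_nonneg_nonneg)
    then show ?thesis using a by (simp add: algebra_simps)
  qed
  then show ?thesis using pc by (intro exI[of _ p] exI[of _ c] conjI) auto
qed

section \<open>Representation of affine minorants by measures\<close>

text \<open>The Archimedean principle, used to read off the sign of a slope from a bound along a
  ray.\<close>

lemma nonpos_if_multiples_bounded:
  fixes a b :: real
  assumes "\<And>n::nat. real n * a \<le> b"
  shows "a \<le> 0"
proof (rule ccontr)
  assume "\<not> a \<le> 0"
  then obtain n :: nat where "b < real n * a" using reals_Archimedean3[of a] by auto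
  then show False using assms[of n] by simp
qed

section \<open>The linear part of a single affine minorant\<close>

context
  fixes M :: "'a measure" and \<rho> p :: "('a \<Rightarrow> real) \<Rightarrow> real" and c :: real
  assumes prob: "prob_space M" and \<rho>: "convex_expectation M \<rho>"
    and lin: "linear_functional_on {X. integrable M X} p"
    and minorant: "\<And>W. integrable M W \<Longrightarrow> p W - c \<le> \<rho> W"
begin

interpretation prob_space M by (rule prob)

lemma integrable_indicator_event: "A \<in> sets M \<Longrightarrow> integrable M (indicator A :: 'a \<Rightarrow> real)"
  by (intro integrable_real_indicator) (auto simp: less_top[symmetric])

lemma minorant_add: "integrable M X \<Longrightarrow> integrable M Y \<Longrightarrow> p (\<lambda>w. X w + Y w) = p X + p Y"
  and minorant_scale: "integrable M X \<Longrightarrow> p (\<lambda>w. t * X w) = t * p X"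
  using linear_functional_onD[OF lin] by simp_all

text \<open>Along the ray of multiples of \<open>X - Y \<le> 0\<close> the functional
  \<open>\<rho>\<close> stays below its value at zero; a positive value of \<open>p\<close> on that
  ray would eventually violate the minorant inequality.\<close>

lemma minorant_mono:
  assumes X: "integrable M X" and Y: "integrable M Y" and le: "AE x in M. X x \<le> Y x"
  shows "p X \<le> p Y"
proof -
  let ?U = "\<lambda>x. X x + (-1) * Y x"
  have "real n * p ?U \<le> \<rho> (\<lambda>_. 0) + c" for n :: nat
  proof -
    have "real n * p ?U - c \<le> \<rho> (\<lambda>x. real n * ?U x)"
      using minorant[of "\<lambda>x. real n * ?U x"] minorant_scale[of ?U "real n"] X Y by simp
    also have "\<dots> \<le> \<rho> (\<lambda>_. 0)"
      by (rule convex_expectation_mono[OF \<rho>])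
        (use X Y le in \<open>auto elim!: eventually_mono intro!: mult_nonneg_nonpos\<close>)
    finally show ?thesis by simp
  qed
  then have "p ?U \<le> 0" by (rule nonpos_if_multiples_bounded)
  moreover have "p ?U = p X - p Y"
    using minorant_add[of X "\<lambda>x. (-1) * Y x"] minorant_scale[of Y "-1"] X Y by simp
  ultimately show ?thesis by simp
qed

text \<open>On constants \<open>\<rho>\<close> has slope one in both directions. Any other slope of
  \<open>p\<close> would overtake it towards plus or minus infinity.\<close>

lemma minorant_one: "p (\<lambda>_. 1) = 1"
proof -
  have \<rho>c: "\<rho> (\<lambda>_. b) = \<rho> (\<lambda>_. 0) + b" for b
    using convex_expectation_translate[OF \<rho>, of "\<lambda>_. 0" b] by simp
  have pc: "p (\<lambda>_. b) = b * p (\<lambda>_. 1)" for b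
    using minorant_scale[of "\<lambda>_. 1" b] by simp
  have "real n * (p (\<lambda>_. 1) - 1) \<le> \<rho> (\<lambda>_. 0) + c" for n :: nat
    using minorant[of "\<lambda>_. real n"] unfolding \<rho>c[of "real n"] pc[of "real n"]
    by (simp add: algebra_simps)
  then have "p (\<lambda>_. 1) - 1 \<le> 0" by (rule nonpos_if_multiples_bounded)
  moreover have "real n * (1 - p (\<lambda>_. 1)) \<le> \<rho> (\<lambda>_. 0) + c" for n :: nat
    using minorant[of "\<lambda>_. - real n"] unfolding \<rho>c[of "- real n"] pc[of "- real n"]
    by (simp add: algebra_simps)
  then have "1 - p (\<lambda>_. 1) \<le> 0" by (rule nonpos_if_multiples_bounded)
  ultimately show ?thesis by simp
qed

text \<open>Makes the continuity and dominated convergence results available for \<open>p\<close>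
  itself.\<close>

lemma minorant_convex_expectation: "convex_expectation M p"
  unfolding convex_expectation_def
proof (intro conjI allI impI)
  show "p (\<lambda>x. X x + b) = p X + b" if "integrable M X" for X b
    using minorant_add[OF that, of "\<lambda>_. b"] minorant_scale[of "\<lambda>_. 1" b] minorant_one by simp
  show "p (\<lambda>x. l * X x + (1 - l) * Y x) \<le> l * p X + (1 - l) * p Y"
    if "integrable M X" "integrable M Y" for X Y l
    using minorant_add[of "\<lambda>x. l * X x" "\<lambda>x. (1 - l) * Y x"] minorant_scale that by simp
qed (rule minorant_mono)

lemma minorant_zero: "p (\<lambda>_. 0) = 0"
  using minorant_scale[of "\<lambda>_. 0" 0] by simp

text \<open>Continuity at zero turned into boundedness by scaling. The constant \<open>C\<close>
  becomes the bound of the density.\<close>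

lemma minorant_indicator_bound:
  "\<exists>C\<ge>0. \<forall>A\<in>sets M. p (indicator A) \<le> C * measure M A"
proof -
  obtain d where d: "d > 0" "\<And>Y. integrable M Y \<Longrightarrow> (\<integral>x. \<bar>Y x\<bar> \<partial>M) < d \<Longrightarrow> \<bar>p Y\<bar> < 1"
    using convex_expectation_continuous[OF minorant_convex_expectation, of "\<lambda>_. 0" 1] minorant_zero
    by auto
  have "p (indicator A) \<le> 2 / d * measure M A" if A: "A \<in> sets M" for A
  proof (cases "measure M A = 0")
    case True
    then have "AE x in M. indicator A x = (0::real)"
      using A by (intro AE_I[of _ _ A]) (auto simp: emeasure_eq_measure indicator_def)
    then have "p (indicator A) \<le> p (\<lambda>_. 0)"
      using A by (intro minorant_mono integrable_indicator_event) (auto elim: eventually_mono)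
    then show ?thesis using True minorant_zero by simp
  next
    case False
    \<comment> \<open>Scales the indicator to have integral \<open>d / 2\<close>, inside the ball of
      continuity; this is the origin of the constant \<open>2 / d\<close>.\<close>
    define t where "t = d / (2 * measure M A)"
    have m: "measure M A > 0" using False by (simp add: zero_less_measure_iff)
    have t: "t > 0" using d(1) m by (simp add: t_def)
    have "(\<integral>x. \<bar>t * indicator A x\<bar> \<partial>M) = t * measure M A"
      using t A by (simp add: abs_mult)
    also have "\<dots> < d" using d(1) m by (simp add: t_def)
    finally have "\<bar>p (\<lambda>x. t * indicator A x)\<bar> < 1"
      using integrable_indicator_event[OF A] by (intro d(2)) auto
    then have "t * p (indicator A) < 1" using minorant_scale[of "indicator A" t] integrable_indicator_event[OF A] t by (simp add: abs_less_iff)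
    then show ?thesis using d(1) m by (simp add: t_def field_simps)
  qed
  then show ?thesis using d(1) by (intro exI[of _ "2 / d"]) auto
qed

text \<open>Countable additivity is continuity of \<open>p\<close>: the partial sums of the
  indicators converge pointwise and are dominated by the constant one.\<close>

lemma minorant_sums:
  assumes A: "range A \<subseteq> sets M" "disjoint_family A"
  shows "(\<lambda>i::nat. p (indicator (A i))) sums p (indicator (\<Union>i. A i))"
proof -
  let ?S = "\<lambda>n x. \<Sum>i<n. indicator (A i) x :: real"
  have Ai: "A i \<in> sets M" for i using A by auto
  have int: "integrable M (indicator (A i) :: 'a \<Rightarrow> real)" for i
    by (rule integrable_indicator_event[OF Ai])
  have sum: "p (?S n) = (\<Sum>i<n. p (indicator (A i)))" for n
  proof (induction n)
    case (Suc n)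
    have "integrable M (?S n)" using int by simp
    from minorant_add[OF this int[of n]] Suc show ?case by simp
  qed (simp add: minorant_zero)
  have sums: "(\<lambda>i. indicator (A i) x :: real) sums indicator (\<Union>i. A i) x" for x
    using A(2) by (intro indicator_sums) (auto simp: disjoint_family_on_def)
  have le: "?S n x \<le> 1" for n x
  proof -
    have "?S n x \<le> (\<Sum>i. indicator (A i) x)"
      using sums_summable[OF sums] by (intro sum_le_suminf) auto
    also have "\<dots> = indicator (\<Union>i. A i) x" using sums_unique[OF sums] by simp
    also have "\<dots> \<le> 1" by (rule indicator_le_1)
    finally show ?thesis .
  qed
  have "(\<lambda>n. p (?S n)) \<longlonglongrightarrow> p (indicator (\<Union>i. A i))"
  proof (rule convex_expectation_dominated_tendsto[OF minorant_convex_expectation, where W="\<lambda>_. 1"])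
    show "AE x in M. \<bar>?S n x\<bar> \<le> 1" for n using le by (auto simp: abs_of_nonneg sum_nonneg)
    show "AE x in M. (\<lambda>n. ?S n x) \<longlonglongrightarrow> indicator (\<Union>i. A i) x"
      using sums by (auto simp: sums_def)
  qed (use Ai in auto)
  then show ?thesis unfolding sums_def sum .
qed

lemma minorant_nonneg: "A \<in> sets M \<Longrightarrow> 0 \<le> p (indicator A)"
  using minorant_mono[of "\<lambda>_. 0" "indicator A"] minorant_zero integrable_indicator_event by simp

definition minorant_measure :: "'a measure" where
  "minorant_measure = measure_of (space M) (sets M) (\<lambda>A. ennreal (p (indicator A)))"

lemma sets_minorant_measure [simp, measurable_cong]: "sets minorant_measure = sets M"
  and space_minorant_measure [simp]: "space minorant_measure = space M"
  by (simp_all add: minorant_measure_def)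

lemma emeasure_minorant_measure:
  assumes "A \<in> sets M"
  shows "emeasure minorant_measure A = ennreal (p (indicator A))"
  unfolding minorant_measure_def
proof (rule emeasure_measure_of_sigma)
  show "sigma_algebra (space M) (sets M)" by (rule sets.sigma_algebra_axioms)
  have "indicator {} = (\<lambda>_::'a. 0::real)" by auto
  then have "p (indicator {}) = 0" using minorant_zero by simp
  then show "positive (sets M) (\<lambda>A. ennreal (p (indicator A)))" by (simp add: positive_def)
  show "countably_additive (sets M) (\<lambda>A. ennreal (p (indicator A)))"
    unfolding countably_additive_def
  proof (intro allI impI)
    fix A :: "nat \<Rightarrow> 'a set" assume A: "range A \<subseteq> sets M" "disjoint_family A"
    show "(\<Sum>i. ennreal (p (indicator (A i)))) = ennreal (p (indicator (\<Union> (range A))))"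
      using A by (intro suminf_ennreal_eq minorant_sums minorant_nonneg) auto
  qed
qed (rule assms)

lemma minorant_measure_ac: "minorant_measure \<in> ac_prob_measures M"
proof -
  have "prob_space minorant_measure"
  proof (rule prob_spaceI)
    have "p (indicator (space M)) = p (\<lambda>_. 1)"
      by (rule convex_expectation_cong_AE[OF minorant_convex_expectation])
        (auto intro: integrable_indicator_event)
    then show "emeasure minorant_measure (space minorant_measure) = 1"
      by (simp add: emeasure_minorant_measure minorant_one)
  qed
  moreover have "absolutely_continuous M minorant_measure"
    unfolding absolutely_continuous_def
  proof
    fix A assume A: "A \<in> null_sets M"
    obtain C where C: "p (indicator A) \<le> C * measure M A"
      using minorant_indicator_bound A by (auto simp: null_sets_def)
    have "measure M A = 0" using A by (auto simp: measure_def null_sets_def)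
    then have "p (indicator A) \<le> 0" using C by simp
    then show "A \<in> null_sets minorant_measure"
      using A by (auto simp: null_sets_def emeasure_minorant_measure ennreal_eq_0_iff)
  qed
  ultimately show ?thesis by (simp add: ac_prob_measures_def)
qed

text \<open>On the set where the density exceeds \<open>C\<close> the measure is at most
  \<open>C\<close> times that of \<open>M\<close>, so the excess over \<open>C\<close> integrates to
  zero and the set is null.\<close>

lemma minorant_measure_density_bounded:
  "\<exists>C. AE x in M. RN_deriv M minorant_measure x \<le> ennreal C"
proof -
  let ?N = minorant_measure and ?f = "RN_deriv M minorant_measure"
  obtain C where C: "C \<ge> 0" "\<And>A. A \<in> sets M \<Longrightarrow> p (indicator A) \<le> C * measure M A"
    using minorant_indicator_bound by blast
  have [measurable]: "?f \<in> borel_measurable M" by simp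
  define A where "A = {x \<in> space M. ?f x > ennreal C}"
  have A [measurable]: "A \<in> sets M" unfolding A_def by simp
  have dens: "density M ?f = ?N"
    using minorant_measure_ac by (intro density_RN_deriv) (auto simp: ac_prob_measures_def)
  have "(\<integral>\<^sup>+x. ?f x * indicator A x \<partial>M) = emeasure ?N A"
    by (subst dens[symmetric]) (simp add: emeasure_density)
  also have "\<dots> \<le> ennreal (C * measure M A)"
    using C(2)[OF A] by (simp add: emeasure_minorant_measure ennreal_leI)
  also have "\<dots> = ennreal C * emeasure M A"
    using C(1) by (simp add: emeasure_eq_measure ennreal_mult)
  finally have le: "(\<integral>\<^sup>+x. ?f x * indicator A x \<partial>M) \<le> ennreal C * emeasure M A" .
  \<comment> \<open>Truncated subtraction of \<open>ennreal\<close> commutes with the integral only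
    when the subtrahend has a finite integral.\<close>
  have fin: "ennreal C * emeasure M A \<noteq> \<infinity>"
    by (simp add: ennreal_mult_eq_top_iff emeasure_eq_measure)
  have "(\<integral>\<^sup>+x. ?f x * indicator A x - ennreal C * indicator A x \<partial>M) =
      (\<integral>\<^sup>+x. ?f x * indicator A x \<partial>M) - (\<integral>\<^sup>+x. ennreal C * indicator A x \<partial>M)"
  proof (rule nn_integral_diff)
    show "(\<integral>\<^sup>+x. ennreal C * indicator A x \<partial>M) \<noteq> \<infinity>"
      using fin by (subst nn_integral_cmult_indicator) auto
    show "AE x in M. ennreal C * indicator A x \<le> ?f x * indicator A x"
      by (intro AE_I2) (auto simp: A_def indicator_def)
  qed auto
  also have "\<dots> = (\<integral>\<^sup>+x. ?f x * indicator A x \<partial>M) - ennreal C * emeasure M A"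
    by (simp add: nn_integral_cmult_indicator)
  also have "\<dots> = 0" using le fin by (auto simp: diff_eq_0_iff_ennreal less_top le_less_trans)
  finally have "AE x in M. ?f x * indicator A x - ennreal C * indicator A x = 0"
    by (subst (asm) nn_integral_0_iff_AE) auto
  then have "AE x in M. ?f x \<le> ennreal C"
  proof (rule AE_mp, intro AE_I2 impI)
    fix x assume x: "x \<in> space M" "?f x * indicator A x - ennreal C * indicator A x = 0"
    then show "?f x \<le> ennreal C"
      by (cases "x \<in> A") (auto simp: diff_eq_0_iff_ennreal A_def)
  qed
  then show ?thesis by blast
qed

end

section \<open>Bounded densities and the integral representation\<close>

lemma bounded_density:
  assumes "prob_space M" and ac: "absolutely_continuous M P" "sets P = sets M"
    and C: "AE x in M. RN_deriv M P x \<le> ennreal C"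
  obtains g where "g \<in> borel_measurable M" "\<And>x. 0 \<le> g x" "AE x in M. g x \<le> max C 0"
    "AE x in M. RN_deriv M P x = ennreal (g x)" "P = density M g"
proof -
  interpret prob_space M by fact
  define g where "g x = enn2real (RN_deriv M P x)" for x
  have [measurable]: "g \<in> borel_measurable M" unfolding g_def by simp
  have RN: "AE x in M. RN_deriv M P x = ennreal (g x)"
    using C
  proof eventually_elim
    case (elim x)
    then have "RN_deriv M P x < top" using ennreal_less_top le_less_trans by blast
    then show ?case by (simp add: g_def)
  qed
  have g0: "0 \<le> g x" for x by (simp add: g_def)
  \<comment> \<open>\<open>ennreal C\<close> is zero for negative \<open>C\<close>, hence the
    maximum.\<close>
  have gC: "AE x in M. g x \<le> max C 0"
    using C RN by eventually_elim (auto simp: ennreal_le_iff2)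
  have "P = density M (RN_deriv M P)"
    using density_RN_deriv[OF ac] by simp
  also have "\<dots> = density M g"
    by (rule density_cong) (use RN in auto)
  finally show thesis using that[of g] g0 gC RN by simp
qed

lemma integrable_bounded_mult:
  fixes g X :: "'a \<Rightarrow> real"
  assumes "g \<in> borel_measurable M" "\<And>x. 0 \<le> g x" "AE x in M. g x \<le> C" and X: "integrable M X"
  shows "integrable M (\<lambda>x. g x * X x)"
proof (rule Bochner_Integration.integrable_bound)
  show "integrable M (\<lambda>x. C * X x)" using X by simp
  show "AE x in M. norm (g x * X x) \<le> norm (C * X x)"
    using assms(3)
  proof eventually_elim
    case (elim x)
    then have "\<bar>g x\<bar> \<le> \<bar>C\<bar>" using assms(2)[of x] by linarith
    then show ?case by (simp add: abs_mult mult_right_mono)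
  qed
qed (use assms in auto)

lemma bounded_density_integrable:
  fixes X :: "'a \<Rightarrow> real"
  assumes "prob_space M" "absolutely_continuous M P" "sets P = sets M"
    "AE x in M. RN_deriv M P x \<le> ennreal C" and X: "integrable M X"
  shows "integrable P X"
proof -
  obtain g where g: "g \<in> borel_measurable M" "\<And>x. 0 \<le> g x" "AE x in M. g x \<le> max C 0"
    and dens: "P = density M g"
    using bounded_density[OF assms(1-4)] by blast
  show ?thesis
    unfolding dens using integrable_bounded_mult[OF g X] X g by (subst integrable_density) auto
qed

text \<open>On indicators the representation holds by construction of the measure; linearity and
  dominated convergence, under \<open>p\<close> and under the measure alike, carry it to all
  integrable functions. The minorant inequality then says that the conjugate is at most
  \<open>c\<close>, hence finite.\<close>

lemma minorant_representation:
  assumes prob: "prob_space M" and \<rho>: "convex_expectation M \<rho>"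
    and lin: "linear_functional_on {X. integrable M X} p"
    and minorant: "\<And>W. integrable M W \<Longrightarrow> p W - c \<le> \<rho> W"
  obtains P where "P \<in> representing_measures M \<rho>"
    "\<And>X. integrable M X \<Longrightarrow> p X = (\<integral>x. X x \<partial>P)"
proof -
  interpret prob_space M by (rule prob)
  note ctx = prob \<rho> lin minorant
  let ?P = "minorant_measure M p"
  note pce = minorant_convex_expectation[OF ctx]
  have P: "prob_space ?P" "sets ?P = sets M" "absolutely_continuous M ?P"
    using minorant_measure_ac[OF ctx] by (auto simp: ac_prob_measures_def)
  have space_P: "space ?P = space M" using P(2) by (rule sets_eq_imp_space_eq)
  interpret P: prob_space ?P by (rule P)
  have space_P: "space ?P = space M" using P(2) by (rule sets_eq_imp_space_eq)
  interpret P: prob_space ?P by (rule P)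
  obtain C where C: "AE x in M. RN_deriv M ?P x \<le> ennreal C"
    using minorant_measure_density_bounded[OF ctx] by blast
  have intP: "integrable ?P X" if X: "integrable M X" for X :: "'a \<Rightarrow> real"
    by (rule bounded_density_integrable[OF prob P(3,2) C X])
  have rep: "p X = (\<integral>x. X x \<partial>?P)" if "integrable M X" for X
    using that
  proof (induction rule: integrable_induct)
    case (base A b)
    have "p (\<lambda>x. b * indicator A x) = b * p (indicator A)"
      using linear_functional_onD(2)[OF lin, of "indicator A" b]
        integrable_indicator_event[OF ctx base(1)] by simp
    moreover have "p (indicator A) = measure ?P A"
      using emeasure_minorant_measure[OF ctx base(1)] minorant_nonneg[OF ctx base(1)]
      by (simp add: measure_def)
    ultimately show ?case using base(1) P(2) by (simp add: mult.commute)
  next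
    case (add f g)
    then show ?case
      using linear_functional_onD(1)[OF lin, of f g] intP by simp
  next
    case (lim f s)
    \<comment> \<open>The dominating function is the bound that \<open>integrable_induct\<close>
      supplies for its approximations.\<close>
    have "(\<lambda>i. p (s i)) \<longlonglongrightarrow> p f"
      by (rule convex_expectation_dominated_tendsto[OF pce, where W="\<lambda>x. 2 * \<bar>f x\<bar>"])
        (use lim in auto)
    moreover have "(\<lambda>i. \<integral>x. s i x \<partial>?P) \<longlonglongrightarrow> (\<integral>x. f x \<partial>?P)"
      by (rule integral_dominated_convergence[where w="\<lambda>x. 2 * \<bar>f x\<bar>"])
        (use lim space_P intP[OF lim.hyps(1)] intP[OF lim.prems] in auto)
    ultimately show ?case unfolding lim.IH by (rule LIMSEQ_unique)
  qed
  have "convex_conjugate M \<rho> ?P \<le> ereal c"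
    unfolding convex_conjugate_def
    using minorant by (intro SUP_least) (simp add: rep[symmetric] algebra_simps)
  then have "?P \<in> representing_measures M \<rho>"
    using minorant_measure_ac[OF ctx] C
    by (auto simp: representing_measures_def less_top[symmetric] top_unique)
  then show thesis using rep by (rule that)
qed

section \<open>Existence of optimal tests\<close>

lemma (in prob_space) integrable_unit_valued:
  fixes t :: "'a \<Rightarrow> real"
  assumes "t \<in> borel_measurable M" "AE x in M. 0 \<le> t x \<and> t x \<le> 1"
  shows "integrable M t" "integrable M (\<lambda>x. (t x)\<^sup>2)"
proof -
  have "AE x in M. norm (t x) \<le> 1" "AE x in M. norm ((t x)\<^sup>2) \<le> 1"
    using assms(2) by (eventually_elim, simp add: power_le_one)+
  then show "integrable M t" "integrable M (\<lambda>x. (t x)\<^sup>2)"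
    using assms(1) by (auto intro!: integrable_const_bound simp del: real_norm_def)
qed

text \<open>Elements of almost minimal \<open>L\<^sup>2\<close>-norm in a decreasing sequence of convex sets are Cauchy
  by the parallelogram law.\<close>

lemma (in prob_space) nested_midpoint_convex_Cauchy:
  fixes T :: "nat \<Rightarrow> ('a \<Rightarrow> real) set"
  assumes ne: "\<And>n. T n \<noteq> {}" and dec: "decseq T"
    and unit: "\<And>n t. t \<in> T n \<Longrightarrow> t \<in> borel_measurable M \<and> (AE x in M. 0 \<le> t x \<and> t x \<le> 1)"
    and mid: "\<And>n t u. t \<in> T n \<Longrightarrow> u \<in> T n \<Longrightarrow> (\<lambda>x. (t x + u x) / 2) \<in> T n"
  shows "\<exists>t. (\<forall>n. t n \<in> T n) \<and>
    (\<forall>e>0. \<exists>N. \<forall>i\<ge>N. \<forall>j\<ge>N. (\<integral>x. \<bar>t i x - t j x\<bar> \<partial>M) < e)"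
proof -
  define q where "q t = (\<integral>x. (t x)\<^sup>2 \<partial>M)" for t :: "'a \<Rightarrow> real"
  define I where "I n = (INF t\<in>T n. q t)" for n
  have q0: "0 \<le> q t" for t by (simp add: q_def)
  have bdd: "bdd_below (q ` T n)" for n by (rule bdd_belowI2[where m=0]) (rule q0)
  have q1: "q t \<le> 1" if "t \<in> T n" for t n
  proof -
    have t: "t \<in> borel_measurable M" "AE x in M. 0 \<le> t x \<and> t x \<le> 1"
      using unit[OF that] by blast+
    from t(2) have "AE x in M. (t x)\<^sup>2 \<le> 1" by eventually_elim (simp add: power_le_one)
    then have "q t \<le> (\<integral>x. 1 \<partial>M)"
      unfolding q_def using integrable_unit_valued(2)[OF t] by (intro integral_mono_AE) auto
    then show ?thesis by (simp add: prob_space)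
  qed
  have I_le: "I n \<le> q t" if "t \<in> T n" for n t
    unfolding I_def by (rule cINF_lower[OF bdd that])
  have "incseq I"
    unfolding incseq_def
  proof (intro allI impI)
    fix m n :: nat assume "m \<le> n"
    then have "T n \<subseteq> T m" using dec by (simp add: decseq_def)
    then show "I m \<le> I n" unfolding I_def by (intro cINF_superset_mono ne bdd) auto
  qed
  moreover have "I n \<le> 1" for n
  proof -
    obtain t where t: "t \<in> T n" using ne[of n] by auto
    show ?thesis using I_le[OF t] q1[OF t] by (rule order_trans)
  qed
  ultimately obtain L where L: "I \<longlonglongrightarrow> L" "\<And>n. I n \<le> L"
    using incseq_convergent[of I 1] by blast
  have "\<exists>t. t \<in> T n \<and> q t < I n + 1 / real (Suc n)" for n
  proof -
    have "(INF t\<in>T n. q t) < I n + 1 / real (Suc n)" by (simp flip: I_def)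
    then show ?thesis using cINF_less_iff[OF ne bdd] by blast
  qed
  then obtain t where t: "\<And>n. t n \<in> T n" "\<And>n. q (t n) < I n + 1 / real (Suc n)"
    using choice[of "\<lambda>n t. t \<in> T n \<and> q t < I n + 1 / real (Suc n)"] by auto
  note ti = integrable_unit_valued[OF conjunct1[OF unit[OF t(1)]] conjunct2[OF unit[OF t(1)]]]
  have tm [measurable]: "t n \<in> borel_measurable M" for n using unit[OF t(1)] by simp
  have sq: "integrable M (\<lambda>x. (t i x - t j x)\<^sup>2)" for i j
  proof (rule integrable_const_bound[where B=1])
    show "AE x in M. norm ((t i x - t j x)\<^sup>2) \<le> 1"
      using conjunct2[OF unit[OF t(1)[of i]]] conjunct2[OF unit[OF t(1)[of j]]]
    proof eventually_elim
      case (elim x)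
      then have "\<bar>t i x - t j x\<bar> \<le> 1" by linarith
      then show ?case by (simp add: abs_square_le_1)
    qed
  qed simp
  \<comment> \<open>For \<open>i \<le> j\<close> both functions lie in \<open>T i\<close>, so their
    midpoint has squared norm at least \<open>I i\<close>. The parallelogram identity, near
    minimality of both, and \<open>I j \<le> L\<close> give the bound.\<close>
  have par: "(\<integral>x. (t i x - t j x)\<^sup>2 \<partial>M) \<le> 2 * (L - I i) + 4 / real (Suc i)" if "i \<le> j" for i j
  proof -
    let ?m = "\<lambda>x. (t i x + t j x) / 2"
    have "t j \<in> T i" using t(1)[of j] dec that by (auto simp: decseq_def)
    then have m: "?m \<in> T i" by (rule mid[OF t(1)])
    have "(\<integral>x. (t i x - t j x)\<^sup>2 \<partial>M) + 4 * q ?m = (\<integral>x. (t i x - t j x)\<^sup>2 + 4 * (?m x)\<^sup>2 \<partial>M)"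
      using sq integrable_unit_valued[OF conjunct1[OF unit[OF m]] conjunct2[OF unit[OF m]]]
      by (simp add: q_def)
    also have "\<dots> = (\<integral>x. 2 * (t i x)\<^sup>2 + 2 * (t j x)\<^sup>2 \<partial>M)"
      by (intro Bochner_Integration.integral_cong) (auto simp: power2_eq_square field_simps)
    also have "\<dots> = 2 * q (t i) + 2 * q (t j)" using ti by (simp add: q_def)
    finally have "(\<integral>x. (t i x - t j x)\<^sup>2 \<partial>M) = 2 * q (t i) + 2 * q (t j) - 4 * q ?m" by simp
    moreover have "1 / real (Suc j) \<le> 1 / real (Suc i)" using that by (simp add: frac_le)
    moreover have "4 / real (Suc i) = 4 * (1 / real (Suc i))" by simp
    ultimately show ?thesis
      using t(2)[of i] t(2)[of j] I_le[OF m] L(2)[of j] by argo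
  qed
  have "\<exists>N. \<forall>i\<ge>N. \<forall>j\<ge>N. (\<integral>x. \<bar>t i x - t j x\<bar> \<partial>M) < e" if e: "e > 0" for e
  proof -
    \<comment> \<open>Passes from the squared L2 distance to the L1 distance: once the former is
      below \<open>e\<^sup>2\<close>, the two terms contribute \<open>e / 2\<close> and less than
      \<open>e / 2\<close>.\<close>
    have am_gm: "\<bar>d\<bar> \<le> e / 2 + d\<^sup>2 / (2 * e)" for d
    proof -
      have "0 \<le> (\<bar>d\<bar> - e)\<^sup>2" by simp
      then have "2 * \<bar>d\<bar> * e \<le> e\<^sup>2 + d\<^sup>2" by (simp add: power2_diff)
      then show ?thesis using e by (simp add: field_simps power2_eq_square)
    qed
    have "(\<lambda>n. 2 * (L - I n) + 4 / real (Suc n)) \<longlonglongrightarrow> 2 * (L - L) + 0"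
      by (intro tendsto_intros L) (use LIMSEQ_Suc[OF lim_const_over_n[of "4::real"]] in simp)
    then have "\<forall>\<^sub>F n in sequentially. 2 * (L - I n) + 4 / real (Suc n) < e\<^sup>2"
      using e by (intro order_tendstoD(2)) auto
    then obtain N where N: "\<And>n. n \<ge> N \<Longrightarrow> 2 * (L - I n) + 4 / real (Suc n) < e\<^sup>2"
      by (auto simp: eventually_sequentially)
    have "(\<integral>x. \<bar>t i x - t j x\<bar> \<partial>M) < e" if "i \<ge> N" "j \<ge> N" for i j
    proof -
      have "(\<integral>x. (t i x - t j x)\<^sup>2 \<partial>M) < e\<^sup>2"
      proof (cases "i \<le> j")
        case True
        then show ?thesis using par[of i j] N[OF that(1)] by simp
      next
        case False
        then show ?thesis using par[of j i] N[OF that(2)] by (simp add: power2_commute)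
      qed
      moreover have "(\<integral>x. \<bar>t i x - t j x\<bar> \<partial>M) \<le> (\<integral>x. e / 2 + (t i x - t j x)\<^sup>2 / (2 * e) \<partial>M)"
      proof (rule integral_mono)
        show "\<bar>t i x - t j x\<bar> \<le> e / 2 + (t i x - t j x)\<^sup>2 / (2 * e)" for x
          by (rule am_gm)
      qed (use ti sq in auto)
      moreover have "(\<integral>x. e / 2 + (t i x - t j x)\<^sup>2 / (2 * e) \<partial>M) =
          e / 2 + (\<integral>x. (t i x - t j x)\<^sup>2 \<partial>M) / (2 * e)"
        using sq by (simp add: prob_space)
      moreover have "(\<integral>x. (t i x - t j x)\<^sup>2 \<partial>M) / (2 * e) < e / 2"
        using e \<open>(\<integral>x. (t i x - t j x)\<^sup>2 \<partial>M) < e\<^sup>2\<close>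
        by (simp add: divide_less_eq power2_eq_square del: power2_diff)
      ultimately show ?thesis by linarith
    qed
    then show ?thesis by blast
  qed
  then show ?thesis using t(1) by blast
qed

section \<open>The constrained problem and attainment of its value\<close>

locale test_problem = prob_space M for M :: "'a measure" +
  fixes \<rho>\<^sub>1 \<rho>\<^sub>2 :: "('a \<Rightarrow> real) \<Rightarrow> real" and K\<^sub>1 K\<^sub>2 :: "'a \<Rightarrow> real" and \<alpha> :: real
  assumes \<rho>\<^sub>1: "convex_expectation M \<rho>\<^sub>1"
    and \<rho>\<^sub>2: "convex_expectation M \<rho>\<^sub>2"
    and K\<^sub>1: "integrable M K\<^sub>1"
    and K\<^sub>2: "integrable M K\<^sub>2"
    and K_less: "AE x in M. K\<^sub>1 x < K\<^sub>2 x"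
    and K\<^sub>1_feasible: "\<rho>\<^sub>1 K\<^sub>1 \<le> \<alpha>"
begin

abbreviation "feasible \<equiv> feasible_tests M \<rho>\<^sub>1 K\<^sub>1 K\<^sub>2 \<alpha>"

text \<open>The full order interval without the bound on \<open>\<rho>\<^sub>1\<close>. Multipliers
  allow minimisation over this larger set.\<close>

definition tests :: "('a \<Rightarrow> real) set" where
  "tests = {X. integrable M X \<and> (AE x in M. K\<^sub>1 x \<le> X x \<and> X x \<le> K\<^sub>2 x)}"

definition risk :: "('a \<Rightarrow> real) \<Rightarrow> real" where
  "risk X = \<rho>\<^sub>2 (\<lambda>x. K\<^sub>2 x - X x)"

definition optimal_value :: real where
  "optimal_value = (INF X\<in>feasible. risk X)"

lemma feasible_iff: "X \<in> feasible \<longleftrightarrow> X \<in> tests \<and> \<rho>\<^sub>1 X \<le> \<alpha>"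
  by (auto simp: feasible_tests_def tests_def)

lemma optimal_iff: "optimal_test M \<rho>\<^sub>1 \<rho>\<^sub>2 K\<^sub>1 K\<^sub>2 \<alpha> X \<longleftrightarrow> X \<in> feasible \<and> risk X = optimal_value"
  by (simp add: optimal_test_def risk_def optimal_value_def)

lemma integrable_tests: "X \<in> tests \<Longrightarrow> integrable M X"
  by (simp add: tests_def)

lemma tests_bounds: "X \<in> tests \<Longrightarrow> AE x in M. K\<^sub>1 x \<le> X x \<and> X x \<le> K\<^sub>2 x"
  unfolding tests_def by blast

lemma K\<^sub>1_tests: "K\<^sub>1 \<in> tests" and K\<^sub>2_tests: "K\<^sub>2 \<in> tests"
  using K\<^sub>1 K\<^sub>2 K_less by (auto simp: tests_def elim!: eventually_mono)

lemma tests_convex: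
  assumes X: "X \<in> tests" and Y: "Y \<in> tests" and l: "0 \<le> l" "l \<le> 1"
  shows "(\<lambda>x. l * X x + (1 - l) * Y x) \<in> tests"
proof -
  have "AE x in M. K\<^sub>1 x \<le> l * X x + (1 - l) * Y x \<and> l * X x + (1 - l) * Y x \<le> K\<^sub>2 x"
    using tests_bounds[OF X] tests_bounds[OF Y]
  proof eventually_elim
    case (elim x)
    have "l * K\<^sub>1 x + (1 - l) * K\<^sub>1 x \<le> l * X x + (1 - l) * Y x"
      "l * X x + (1 - l) * Y x \<le> l * K\<^sub>2 x + (1 - l) * K\<^sub>2 x"
      using elim l by (auto intro!: add_mono mult_left_mono)
    then show ?case by (simp add: algebra_simps)
  qed
  then show ?thesis using X Y by (simp add: tests_def)
qed

lemma risk_convex: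
  assumes X: "X \<in> tests" and Y: "Y \<in> tests" and l: "0 \<le> l" "l \<le> 1"
  shows "risk (\<lambda>x. l * X x + (1 - l) * Y x) \<le> l * risk X + (1 - l) * risk Y"
proof -
  have "(\<lambda>x. K\<^sub>2 x - (l * X x + (1 - l) * Y x)) =
    (\<lambda>x. l * (K\<^sub>2 x - X x) + (1 - l) * (K\<^sub>2 x - Y x))" by (auto simp: algebra_simps)
  then show ?thesis
    using convex_expectation_convex[OF \<rho>\<^sub>2, of "\<lambda>x. K\<^sub>2 x - X x" "\<lambda>x. K\<^sub>2 x - Y x" l] l K\<^sub>2
      integrable_tests[OF X] integrable_tests[OF Y] by (simp add: risk_def)
qed

lemma \<rho>\<^sub>1_convex:
  assumes "X \<in> tests" "Y \<in> tests" "0 \<le> l" "l \<le> 1"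
  shows "\<rho>\<^sub>1 (\<lambda>x. l * X x + (1 - l) * Y x) \<le> l * \<rho>\<^sub>1 X + (1 - l) * \<rho>\<^sub>1 Y"
  by (intro convex_expectation_convex[OF \<rho>\<^sub>1] integrable_tests assms)

lemma optimal_value_le: "X \<in> feasible \<Longrightarrow> optimal_value \<le> risk X"
  unfolding optimal_value_def
proof (rule cINF_lower)
  show "bdd_below (risk ` feasible)"
  proof (rule bdd_belowI2)
    fix X assume "X \<in> feasible"
    then show "\<rho>\<^sub>2 (\<lambda>_. 0) \<le> risk X"
      unfolding risk_def
      by (intro convex_expectation_mono[OF \<rho>\<^sub>2])
        (auto simp: feasible_tests_def K\<^sub>2 elim!: eventually_mono)
  qed
qed

lemma almost_optimal:
  assumes "e > 0"
  shows "\<exists>X\<in>feasible. risk X \<le> optimal_value + e"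
proof (rule ccontr)
  assume no: "\<not> ?thesis"
  have "K\<^sub>1 \<in> feasible" using K\<^sub>1_tests K\<^sub>1_feasible by (simp add: feasible_iff)
  then have "optimal_value + e \<le> optimal_value"
    unfolding optimal_value_def
    using no by (intro cINF_greatest) (auto simp: not_le optimal_value_def intro: less_imp_le)
  then show False using assms by simp
qed

text \<open>Tests are written as \<open>K\<^sub>1 + t (K\<^sub>2 - K\<^sub>1)\<close> with
  \<open>t\<close> between 0 and 1, because the L2 argument needs square integrability, which the
  ratios have but \<open>K\<^sub>1\<close> and \<open>K\<^sub>2\<close> need not. The ratios of
  almost optimal tests form decreasing convex sets; an L1 Cauchy choice from them has an almost
  everywhere convergent subsequence, and domination by
  \<open>\<bar>K\<^sub>1\<bar> + \<bar>K\<^sub>2\<bar>\<close> passes constraint and risk to the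
  limit.\<close>

lemma ex_optimal_test: "\<exists>X. optimal_test M \<rho>\<^sub>1 \<rho>\<^sub>2 K\<^sub>1 K\<^sub>2 \<alpha> X"
proof -
  define F where "F t = (\<lambda>x. K\<^sub>1 x + t x * (K\<^sub>2 x - K\<^sub>1 x))" for t :: "'a \<Rightarrow> real"
  have [measurable]: "K\<^sub>1 \<in> borel_measurable M" "K\<^sub>2 \<in> borel_measurable M" using K\<^sub>1 K\<^sub>2 by auto
  define T where "T n = {t. t \<in> borel_measurable M \<and> (AE x in M. 0 \<le> t x \<and> t x \<le> 1) \<and>
    F t \<in> feasible \<and> risk (F t) \<le> optimal_value + 1 / real (Suc n)}" for n
  have ne: "T n \<noteq> {}" for n
  proof -
    obtain X where X: "X \<in> feasible" "risk X \<le> optimal_value + 1 / real (Suc n)"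
      using almost_optimal[of "1 / real (Suc n)"] by auto
    then have Xi: "integrable M X" and Xb: "AE x in M. K\<^sub>1 x \<le> X x \<and> X x \<le> K\<^sub>2 x"
      and XA: "\<rho>\<^sub>1 X \<le> \<alpha>" by (auto simp: feasible_tests_def)
    \<comment> \<open>The denominator is positive almost everywhere, so \<open>X\<close> is
      recovered up to a null set, which neither functional notices.\<close>
    define t where "t x = (X x - K\<^sub>1 x) / (K\<^sub>2 x - K\<^sub>1 x)" for x
    have [measurable]: "t \<in> borel_measurable M" using Xi unfolding t_def by simp
    have t: "AE x in M. (0 \<le> t x \<and> t x \<le> 1) \<and> F t x = X x"
      using Xb K_less by eventually_elim (auto simp: t_def F_def)
    have Fi: "integrable M (F t)"
    proof (rule integrable_cong_AE_imp[OF Xi])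
      show "F t \<in> borel_measurable M" unfolding F_def by measurable
      show "AE x in M. X x = F t x" using t by eventually_elim simp
    qed
    have "\<rho>\<^sub>1 (F t) = \<rho>\<^sub>1 X"
      using t by (intro convex_expectation_cong_AE[OF \<rho>\<^sub>1 Fi Xi]) (auto elim: eventually_mono)
    moreover have "risk (F t) = risk X"
      unfolding risk_def using t Fi Xi K\<^sub>2
      by (intro convex_expectation_cong_AE[OF \<rho>\<^sub>2]) (auto elim: eventually_mono)
    moreover have "AE x in M. K\<^sub>1 x \<le> F t x \<and> F t x \<le> K\<^sub>2 x"
      using t Xb by eventually_elim simp
    ultimately have "t \<in> T n"
      using X XA Fi t by (auto simp: T_def feasible_tests_def elim: eventually_mono)
    then show ?thesis by blast
  qed
  have dec: "decseq T"
  proof (intro decseq_SucI subsetI)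
    fix n t assume "t \<in> T (Suc n)"
    moreover have "1 / real (Suc (Suc n)) \<le> 1 / real (Suc n)" by (simp add: frac_le)
    ultimately show "t \<in> T n" unfolding T_def by (auto intro: order_trans)
  qed
  have mid: "(\<lambda>x. (t x + u x) / 2) \<in> T n" if t: "t \<in> T n" and u: "u \<in> T n" for n t u
  proof -
    have F: "F (\<lambda>x. (t x + u x) / 2) = (\<lambda>x. (1/2) * F t x + (1 - 1/2) * F u x)"
      by (auto simp: F_def field_simps)
    have FT: "F t \<in> tests" "F u \<in> tests" using t u by (auto simp: T_def feasible_iff)
    have "\<rho>\<^sub>1 (F (\<lambda>x. (t x + u x) / 2)) \<le> \<alpha>"
      using \<rho>\<^sub>1_convex[OF FT, of "1/2"] t u unfolding F by (simp add: T_def feasible_iff)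
    moreover have "risk (F (\<lambda>x. (t x + u x) / 2)) \<le> optimal_value + 1 / real (Suc n)"
      using risk_convex[OF FT, of "1/2"] t u unfolding F by (simp add: T_def)
    moreover have "F (\<lambda>x. (t x + u x) / 2) \<in> tests"
      using tests_convex[OF FT, of "1/2"] unfolding F by simp
    moreover have "AE x in M. 0 \<le> t x \<and> t x \<le> 1" "AE x in M. 0 \<le> u x \<and> u x \<le> 1"
      using t u by (auto simp: T_def)
    then have "AE x in M. 0 \<le> (t x + u x) / 2 \<and> (t x + u x) / 2 \<le> 1"
      by eventually_elim auto
    moreover have "(\<lambda>x. (t x + u x) / 2) \<in> borel_measurable M"
      using t u unfolding T_def by (intro borel_measurable_divide borel_measurable_add) auto
    ultimately show ?thesis by (simp add: T_def feasible_iff)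
  qed
  obtain t where t: "\<And>n. t n \<in> T n"
    and Cauchy: "\<And>e. e > 0 \<Longrightarrow> \<exists>N. \<forall>i\<ge>N. \<forall>j\<ge>N. (\<integral>x. \<bar>t i x - t j x\<bar> \<partial>M) < e"
    using nested_midpoint_convex_Cauchy[OF ne dec _ mid] by (auto simp: T_def)
  have tm [measurable]: "t n \<in> borel_measurable M" and t01: "AE x in M. 0 \<le> t n x \<and> t n x \<le> 1"
    and tf: "F (t n) \<in> feasible" and tr: "risk (F (t n)) \<le> optimal_value + 1 / real (Suc n)" for n
    using t[of n] by (auto simp: T_def)
  have "integrable M (t n)" for n by (rule integrable_unit_valued[OF tm t01])
  then obtain r where r: "strict_mono r" "AE x in M. Cauchy (\<lambda>i. t (r i) x)"
    using cauchy_L1_AE_cauchy_subseq[of M t] Cauchy by auto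
  define u where "u x = lim (\<lambda>i. t (r i) x)" for x
  have [measurable]: "u \<in> borel_measurable M" unfolding u_def by measurable
  have lim: "AE x in M. (\<lambda>i. t (r i) x) \<longlonglongrightarrow> u x"
    using r(2) by eventually_elim (simp add: u_def Cauchy_convergent_iff convergent_LIMSEQ_iff)
  have "AE x in M. \<forall>i. 0 \<le> t (r i) x \<and> t (r i) x \<le> 1" using t01 by (simp add: AE_all_countable)
  then have u01: "AE x in M. 0 \<le> u x \<and> u x \<le> 1"
    using lim by eventually_elim (auto intro: LIMSEQ_le_const LIMSEQ_le_const2)
  have FAE: "AE x in M. (\<lambda>i. F (t (r i)) x) \<longlonglongrightarrow> F u x"
    using lim by eventually_elim (auto simp: F_def intro!: tendsto_intros)
  have Fb: "AE x in M. K\<^sub>1 x \<le> F s x \<and> F s x \<le> K\<^sub>2 x" if "AE x in M. 0 \<le> s x \<and> s x \<le> 1" for s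
    using that K_less
  proof eventually_elim
    case (elim x)
    then have "0 \<le> s x * (K\<^sub>2 x - K\<^sub>1 x)" "s x * (K\<^sub>2 x - K\<^sub>1 x) \<le> 1 * (K\<^sub>2 x - K\<^sub>1 x)"
      by (auto intro!: mult_right_mono)
    then show ?case by (simp add: F_def)
  qed
  have Fm [measurable]: "F s \<in> borel_measurable M" if "s \<in> borel_measurable M" for s
    using that unfolding F_def by measurable
  have l1: "(\<lambda>i. \<rho>\<^sub>1 (F (t (r i)))) \<longlonglongrightarrow> \<rho>\<^sub>1 (F u)"
  proof (rule convex_expectation_dominated_tendsto[OF \<rho>\<^sub>1, where W="\<lambda>x. \<bar>K\<^sub>1 x\<bar> + \<bar>K\<^sub>2 x\<bar>"])
    show "AE x in M. \<bar>F (t (r i)) x\<bar> \<le> \<bar>K\<^sub>1 x\<bar> + \<bar>K\<^sub>2 x\<bar>" for i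
      using Fb[OF t01[of "r i"]] by eventually_elim auto
  qed (use K\<^sub>1 K\<^sub>2 FAE in auto)
  have l2: "(\<lambda>i. risk (F (t (r i)))) \<longlonglongrightarrow> risk (F u)"
    unfolding risk_def
  proof (rule convex_expectation_dominated_tendsto[OF \<rho>\<^sub>2, where W="\<lambda>x. \<bar>K\<^sub>1 x\<bar> + \<bar>K\<^sub>2 x\<bar>"])
    show "AE x in M. \<bar>K\<^sub>2 x - F (t (r i)) x\<bar> \<le> \<bar>K\<^sub>1 x\<bar> + \<bar>K\<^sub>2 x\<bar>" for i
      using Fb[OF t01[of "r i"]] by eventually_elim auto
    show "AE x in M. (\<lambda>i. K\<^sub>2 x - F (t (r i)) x) \<longlonglongrightarrow> K\<^sub>2 x - F u x"
      using FAE by eventually_elim (auto intro!: tendsto_intros)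
  qed (use K\<^sub>1 K\<^sub>2 in auto)
  have "\<rho>\<^sub>1 (F u) \<le> \<alpha>"
    by (rule LIMSEQ_le_const2[OF l1]) (use tf in \<open>auto simp: feasible_iff\<close>)
  moreover have "integrable M (F u)"
  proof (rule Bochner_Integration.integrable_bound)
    show "integrable M (\<lambda>x. \<bar>K\<^sub>1 x\<bar> + \<bar>K\<^sub>2 x\<bar>)" using K\<^sub>1 K\<^sub>2 by simp
    show "AE x in M. norm (F u x) \<le> norm (\<bar>K\<^sub>1 x\<bar> + \<bar>K\<^sub>2 x\<bar>)"
      using Fb[OF u01] by eventually_elim auto
  qed simp
  ultimately have u: "F u \<in> feasible" using Fb[OF u01] by (simp add: feasible_tests_def)
  have "risk (F u) \<le> optimal_value + 0"
  proof (rule LIMSEQ_le[OF l2])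
    show "(\<lambda>i. optimal_value + 1 / real (Suc i)) \<longlonglongrightarrow> optimal_value + 0"
      by (intro tendsto_intros) (use LIMSEQ_Suc[OF lim_const_over_n[of "1::real"]] in simp)
    have "risk (F (t (r i))) \<le> optimal_value + 1 / real (Suc i)" for i
    proof -
      have "1 / real (Suc (r i)) \<le> 1 / real (Suc i)"
        using strict_mono_imp_increasing[OF r(1), of i] by (simp add: frac_le)
      then show ?thesis using tr[of "r i"] by linarith
    qed
    then show "\<exists>N. \<forall>i\<ge>N. risk (F (t (r i))) \<le> optimal_value + 1 / real (Suc i)" by blast
  qed
  then show ?thesis using optimal_value_le[OF u] u optimal_iff by (intro exI[of _ "F u"]) auto
qed

end

section \<open>Structure of optimal tests\<close>

text \<open>A real-valued version of the density allows signed combinations such as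
  \<open>b * g - a * h\<close>.\<close>

lemma representing_measure_density:
  assumes "prob_space M" and P: "P \<in> representing_measures M \<rho>"
  shows "\<exists>g. (AE x in M. RN_deriv M P x = ennreal (g x)) \<and> (\<forall>x. 0 \<le> g x) \<and>
    g \<in> borel_measurable M \<and>
    (\<forall>X::'a \<Rightarrow> real. integrable M X \<longrightarrow> integrable M (\<lambda>x. g x * X x)) \<and>
    (\<forall>X::'a \<Rightarrow> real. integrable M X \<longrightarrow> (\<integral>x. X x \<partial>P) = (\<integral>x. g x * X x \<partial>M))"
proof -
  obtain C where C: "AE x in M. RN_deriv M P x \<le> ennreal C"
    and ac: "absolutely_continuous M P" "sets P = sets M"
    using P by (auto simp: representing_measures_def ac_prob_measures_def)
  obtain g where g: "g \<in> borel_measurable M" "\<And>x. 0 \<le> g x" "AE x in M. g x \<le> max C 0"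
    and RN: "AE x in M. RN_deriv M P x = ennreal (g x)" and dens: "P = density M g"
    using bounded_density[OF assms(1) ac C] by blast
  have "(\<integral>x. X x \<partial>P) = (\<integral>x. g x * X x \<partial>M)" if "integrable M X" for X :: "'a \<Rightarrow> real"
    unfolding dens using that g by (subst integral_density) auto
  then show ?thesis
    using RN g integrable_bounded_mult[OF g] by (intro exI[of _ g] conjI allI impI) auto
qed

section \<open>Lagrange multipliers and the linearised problem\<close>

context test_problem
begin

text \<open>The strict inequalities in \<open>A\<close> keep the origin out: a test witnessing it
  would be feasible with risk below the optimum. The slack they introduce is removed at the end by
  letting it tend to zero.\<close>

lemma multipliers:
  "\<exists>a b. 0 \<le> a \<and> 0 \<le> b \<and> (a \<noteq> 0 \<or> b \<noteq> 0) \<and>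
    (\<forall>X\<in>tests. a * optimal_value + b * \<alpha> \<le> a * risk X + b * \<rho>\<^sub>1 X)"
proof -
  define A where "A = {(x, y). \<exists>X\<in>tests. risk X - optimal_value < x \<and> \<rho>\<^sub>1 X - \<alpha> < y}"
  have "convex A"
  proof (rule convexI)
    fix p q :: "real \<times> real" and s t :: real
    assume pq: "p \<in> A" "q \<in> A" and st: "0 \<le> s" "0 \<le> t" "s + t = 1"
    obtain X Y where X: "X \<in> tests" "risk X - optimal_value < fst p" "\<rho>\<^sub>1 X - \<alpha> < snd p"
      and Y: "Y \<in> tests" "risk Y - optimal_value < fst q" "\<rho>\<^sub>1 Y - \<alpha> < snd q"
      using pq by (auto simp: A_def)
    have t: "t = 1 - s" and s: "s \<le> 1" using st by auto
    have less: "s * u + (1 - s) * v < s * u' + (1 - s) * v'" if "u < u'" "v < v'" for u v u' v' :: real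
      using that st s unfolding t
      by (cases "s = 0") (auto intro!: add_less_le_mono mult_strict_left_mono mult_left_mono)
    let ?Z = "\<lambda>x. s * X x + (1 - s) * Y x"
    have "risk ?Z - optimal_value \<le> s * (risk X - optimal_value) + (1 - s) * (risk Y - optimal_value)"
      using risk_convex[OF X(1) Y(1) st(1) s] by (simp add: algebra_simps)
    moreover have "\<rho>\<^sub>1 ?Z - \<alpha> \<le> s * (\<rho>\<^sub>1 X - \<alpha>) + (1 - s) * (\<rho>\<^sub>1 Y - \<alpha>)"
      using \<rho>\<^sub>1_convex[OF X(1) Y(1) st(1) s] by (simp add: algebra_simps)
    ultimately have "(s * fst p + (1 - s) * fst q, s * snd p + (1 - s) * snd q) \<in> A"
      using tests_convex[OF X(1) Y(1) st(1) s] less[OF X(2) Y(2)] less[OF X(3) Y(3)]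
      unfolding A_def mem_Collect_eq case_prod_conv by (intro bexI[of _ ?Z]) auto
    then show "s *\<^sub>R p + t *\<^sub>R q \<in> A"
      by (simp add: t scaleR_prod_def plus_prod_def)
  qed
  moreover have "0 \<notin> A"
  proof
    assume "0 \<in> A"
    then obtain X where "X \<in> tests" "risk X < optimal_value" "\<rho>\<^sub>1 X < \<alpha>"
      by (auto simp: A_def zero_prod_def)
    then show False using optimal_value_le[of X] by (simp add: feasible_iff)
  qed
  ultimately obtain n where n: "n \<noteq> 0" "\<forall>p\<in>A. 0 \<le> inner n p"
    using separating_hyperplane_set_0 by blast
  define a b where "a = fst n" and "b = snd n"
  have ab: "a \<noteq> 0 \<or> b \<noteq> 0" using n(1) by (auto simp: a_def b_def prod_eq_iff)
  have sep: "0 \<le> a * (risk X - optimal_value + s) + b * (\<rho>\<^sub>1 X - \<alpha> + t)"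
    if "X \<in> tests" "s > 0" "t > 0" for X s t
  proof -
    have "(risk X - optimal_value + s, \<rho>\<^sub>1 X - \<alpha> + t) \<in> A"
      using that by (auto simp: A_def intro!: bexI[of _ X])
    then have "0 \<le> inner n (risk X - optimal_value + s, \<rho>\<^sub>1 X - \<alpha> + t)" using n(2) by blast
    then show ?thesis by (simp add: inner_prod_def a_def b_def)
  qed
  \<comment> \<open>\<open>A\<close> is closed upwards, so points may move along a coordinate axis;
    a negative coefficient would make the inner product unbounded below.\<close>
  have "real k * (- a) \<le> a * (risk K\<^sub>1 - optimal_value + 1) + b * (\<rho>\<^sub>1 K\<^sub>1 - \<alpha> + 1)" for k :: nat
    using sep[OF K\<^sub>1_tests, of "1 + real k" 1] by (simp add: algebra_simps)
  then have "- a \<le> 0" by (rule nonpos_if_multiples_bounded)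
  then have a: "0 \<le> a" by simp
  have "real k * (- b) \<le> a * (risk K\<^sub>1 - optimal_value + 1) + b * (\<rho>\<^sub>1 K\<^sub>1 - \<alpha> + 1)" for k :: nat
    using sep[OF K\<^sub>1_tests, of 1 "1 + real k"] by (simp add: algebra_simps)
  then have "- b \<le> 0" by (rule nonpos_if_multiples_bounded)
  then have b: "0 \<le> b" by simp
  have "a * optimal_value + b * \<alpha> \<le> a * risk X + b * \<rho>\<^sub>1 X" if X: "X \<in> tests" for X
  proof (rule field_le_epsilon)
    fix e :: real assume e: "e > 0"
    have pos: "a + b > 0" using a b ab by linarith
    \<comment> \<open>Chosen so that the total weighted slack \<open>(a + b) * s\<close> equals
      \<open>e\<close>.\<close>
    define s where "s = e / (a + b)"
    have "s > 0" "(a + b) * s = e" using e pos by (simp_all add: s_def)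
    then have "0 \<le> a * (risk X - optimal_value) + b * (\<rho>\<^sub>1 X - \<alpha>) + (a + b) * s"
      using sep[OF X, of s s] by (simp add: algebra_simps)
    then show "a * optimal_value + b * \<alpha> \<le> a * risk X + b * \<rho>\<^sub>1 X + e"
      using \<open>(a + b) * s = e\<close> by (simp add: algebra_simps)
  qed
  then show ?thesis using a b ab by blast
qed

lemma saddle_measures:
  assumes a: "0 \<le> a" and b: "0 \<le> b"
    and mult: "\<forall>X\<in>tests. m \<le> a * risk X + b * \<rho>\<^sub>1 X"
  shows "\<exists>P\<in>representing_measures M \<rho>\<^sub>1. \<exists>Q\<in>representing_measures M \<rho>\<^sub>2. \<exists>c d.
    (\<forall>W. integrable M W \<longrightarrow> (\<integral>x. W x \<partial>P) - c \<le> \<rho>\<^sub>1 W) \<and>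
    (\<forall>W. integrable M W \<longrightarrow> (\<integral>x. W x \<partial>Q) - d \<le> \<rho>\<^sub>2 W) \<and>
    (\<forall>X\<in>tests. m \<le> a * ((\<integral>x. K\<^sub>2 x - X x \<partial>Q) - d) + b * ((\<integral>x. X x \<partial>P) - c))"
proof -
  have mean_le: "l * u + (1 - l) * v \<le> l * r + (1 - l) * r'"
    if "u \<le> r" "v \<le> r'" "0 \<le> l" "l \<le> 1" for l u v r r' :: real
    using that by (intro add_mono mult_left_mono) auto
  \<comment> \<open>The upper graph of \<open>a * risk - m\<close> over the tests: nonnegativity on
    it is the multiplier inequality, and its lowest points return that inequality with
    \<open>\<rho>\<^sub>1\<close> linearised.\<close>
  define S where "S = {(X, r). X \<in> tests \<and> a * risk X - m \<le> r}"
  have "\<exists>p c. linear_functional_on {X. integrable M X} p \<and>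
    (\<forall>W. integrable M W \<longrightarrow> p W - c \<le> \<rho>\<^sub>1 W) \<and> (\<forall>(X, r)\<in>S. 0 \<le> b * (p X - c) + r)"
  proof (rule convex_expectation_weighted_sandwich[OF \<rho>\<^sub>1])
    show "S \<noteq> {}" using K\<^sub>1_tests by (auto simp: S_def)
    show "integrable M X" if "(X, r) \<in> S" for X r using that integrable_tests by (simp add: S_def)
    show "0 \<le> b * \<rho>\<^sub>1 X + r" if "(X, r) \<in> S" for X r using that mult by (force simp: S_def)
    show "((\<lambda>x. l * X x + (1 - l) * Y x), l * r + (1 - l) * r') \<in> S"
      if S: "(X, r) \<in> S" "(Y, r') \<in> S" and l: "0 \<le> l" "l \<le> 1" for X r Y r' l
    proof -
      have XY: "X \<in> tests" "Y \<in> tests" "a * risk X - m \<le> r" "a * risk Y - m \<le> r'"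
        using S by (auto simp: S_def)
      have "a * risk (\<lambda>x. l * X x + (1 - l) * Y x) \<le> a * (l * risk X + (1 - l) * risk Y)"
        by (intro mult_left_mono risk_convex XY l a)
      also have "\<dots> - m = l * (a * risk X - m) + (1 - l) * (a * risk Y - m)"
        by (simp add: algebra_simps)
      also have "\<dots> \<le> l * r + (1 - l) * r'" by (intro mean_le XY l)
      finally show ?thesis using tests_convex[OF XY(1,2) l] by (simp add: S_def)
    qed
  qed (rule b)
  then obtain p c where p: "linear_functional_on {X. integrable M X} p"
    and "\<forall>W. integrable M W \<longrightarrow> p W - c \<le> \<rho>\<^sub>1 W"
    and "\<forall>(X, r)\<in>S. 0 \<le> b * (p X - c) + r" by (elim exE conjE)
  then have pc: "\<And>W. integrable M W \<Longrightarrow> p W - c \<le> \<rho>\<^sub>1 W"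
    and pS: "\<And>X r. (X, r) \<in> S \<Longrightarrow> 0 \<le> b * (p X - c) + r"
    by auto
  have p_mult: "m \<le> a * risk X + b * (p X - c)" if "X \<in> tests" for X
    using pS[of X "a * risk X - m"] that by (simp add: S_def)
  obtain P where P: "P \<in> representing_measures M \<rho>\<^sub>1"
    and pP: "\<And>X. integrable M X \<Longrightarrow> p X = (\<integral>x. X x \<partial>P)"
    using minorant_representation[OF prob_space_axioms \<rho>\<^sub>1 p pc] by blast
  \<comment> \<open>Written in the variable \<open>Y = K\<^sub>2 - X\<close>, at which
    \<open>\<rho>\<^sub>2\<close> is evaluated. The other term already contains \<open>p - c\<close>
    in place of \<open>\<rho>\<^sub>1\<close>, so the second separation preserves the first.\<close>
  define T where "T = {(Y, r). (\<lambda>x. K\<^sub>2 x - Y x) \<in> tests \<and> b * (p (\<lambda>x. K\<^sub>2 x - Y x) - c) - m \<le> r}"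
  have "\<exists>q d. linear_functional_on {X. integrable M X} q \<and>
    (\<forall>W. integrable M W \<longrightarrow> q W - d \<le> \<rho>\<^sub>2 W) \<and> (\<forall>(Y, r)\<in>T. 0 \<le> a * (q Y - d) + r)"
  proof (rule convex_expectation_weighted_sandwich[OF \<rho>\<^sub>2])
    show "T \<noteq> {}" using K\<^sub>2_tests by (auto simp: T_def intro!: exI[of _ "\<lambda>_. 0"])
    show "integrable M Y" if "(Y, r) \<in> T" for Y r
    proof -
      have "(\<lambda>x. K\<^sub>2 x - Y x) \<in> tests" using that by (simp add: T_def)
      then have "integrable M (\<lambda>x. K\<^sub>2 x - (K\<^sub>2 x - Y x))"
        by (intro Bochner_Integration.integrable_diff[OF K\<^sub>2] integrable_tests)
      then show ?thesis by simp
    qed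
    show "0 \<le> a * \<rho>\<^sub>2 Y + r" if "(Y, r) \<in> T" for Y r
      using that p_mult[of "\<lambda>x. K\<^sub>2 x - Y x"] by (simp add: T_def risk_def)
    show "((\<lambda>x. l * Y x + (1 - l) * Y' x), l * r + (1 - l) * r') \<in> T"
      if T: "(Y, r) \<in> T" "(Y', r') \<in> T" and l: "0 \<le> l" "l \<le> 1" for Y r Y' r' l
    proof -
      let ?X = "\<lambda>x. K\<^sub>2 x - Y x" and ?X' = "\<lambda>x. K\<^sub>2 x - Y' x"
      have X: "?X \<in> tests" "?X' \<in> tests" "b * (p ?X - c) - m \<le> r" "b * (p ?X' - c) - m \<le> r'"
        using T by (auto simp: T_def)
      have eq: "(\<lambda>x. K\<^sub>2 x - (l * Y x + (1 - l) * Y' x)) = (\<lambda>x. l * ?X x + (1 - l) * ?X' x)"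
        by (auto simp: algebra_simps)
      have Xi: "?X \<in> {X. integrable M X}" "?X' \<in> {X. integrable M X}"
        using X integrable_tests by auto
      have "p (\<lambda>x. l * ?X x + (1 - l) * ?X' x) = p (\<lambda>x. l * ?X x) + p (\<lambda>x. (1 - l) * ?X' x)"
        using Xi by (intro linear_functional_onD[OF p]) auto
      also have "\<dots> = l * p ?X + (1 - l) * p ?X'"
        by (simp add: linear_functional_onD(2)[OF p Xi(1)] linear_functional_onD(2)[OF p Xi(2)])
      finally have p_eq: "p (\<lambda>x. l * ?X x + (1 - l) * ?X' x) = l * p ?X + (1 - l) * p ?X'" .
      have "b * (p (\<lambda>x. l * ?X x + (1 - l) * ?X' x) - c) - m =
          l * (b * (p ?X - c) - m) + (1 - l) * (b * (p ?X' - c) - m)"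
        unfolding p_eq by (simp add: algebra_simps)
      also have "\<dots> \<le> l * r + (1 - l) * r'" by (intro mean_le X l)
      finally show ?thesis
        using tests_convex[OF X(1,2) l] unfolding T_def mem_Collect_eq case_prod_conv eq by blast
    qed
  qed (rule a)
  then obtain q d where q: "linear_functional_on {X. integrable M X} q"
    and "\<forall>W. integrable M W \<longrightarrow> q W - d \<le> \<rho>\<^sub>2 W"
    and "\<forall>(Y, r)\<in>T. 0 \<le> a * (q Y - d) + r" by (elim exE conjE)
  then have qd: "\<And>W. integrable M W \<Longrightarrow> q W - d \<le> \<rho>\<^sub>2 W"
    and qT: "\<And>Y r. (Y, r) \<in> T \<Longrightarrow> 0 \<le> a * (q Y - d) + r"
    by auto
  obtain Q where Q: "Q \<in> representing_measures M \<rho>\<^sub>2"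
    and qQ: "\<And>X. integrable M X \<Longrightarrow> q X = (\<integral>x. X x \<partial>Q)"
    using minorant_representation[OF prob_space_axioms \<rho>\<^sub>2 q qd] by blast
  have "m \<le> a * ((\<integral>x. K\<^sub>2 x - X x \<partial>Q) - d) + b * ((\<integral>x. X x \<partial>P) - c)" if X: "X \<in> tests" for X
  proof -
    have "((\<lambda>x. K\<^sub>2 x - X x), b * (p X - c) - m) \<in> T" using X by (simp add: T_def)
    then have "m \<le> a * (q (\<lambda>x. K\<^sub>2 x - X x) - d) + b * (p X - c)" using qT by fastforce
    then show ?thesis using integrable_tests[OF X] K\<^sub>2 by (simp add: pP qQ)
  qed
  then show ?thesis using P Q pc qd
    by (intro bexI[of _ P] bexI[of _ Q] exI[of _ c] exI[of _ d]) (auto simp: pP qQ)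
qed

text \<open>At an optimal test the weighted minorants lie below the weighted true values, which are
  at most \<open>a * optimal_value + b * \<alpha>\<close>; by \<open>saddle\<close> this constant is
  a lower bound over all tests. So an optimal test is no worse than the pointwise minimiser
  \<open>Z\<close>, although \<open>D * (X - Z)\<close> is nonnegative, and this product must vanish
  almost everywhere.\<close>

lemma optimal_test_bang_bang:
  assumes a: "0 \<le> a" and b: "0 \<le> b"
    and c: "\<forall>W. integrable M W \<longrightarrow> (\<integral>x. W x \<partial>P) - c \<le> \<rho>\<^sub>1 W"
    and d: "\<forall>W. integrable M W \<longrightarrow> (\<integral>x. W x \<partial>Q) - d \<le> \<rho>\<^sub>2 W"
    and saddle: "\<forall>X\<in>tests. a * optimal_value + b * \<alpha> \<le>
      a * ((\<integral>x. K\<^sub>2 x - X x \<partial>Q) - d) + b * ((\<integral>x. X x \<partial>P) - c)"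
    and g: "g \<in> borel_measurable M"
      "\<forall>X::'a \<Rightarrow> real. integrable M X \<longrightarrow> integrable M (\<lambda>x. g x * X x)"
      "\<forall>X::'a \<Rightarrow> real. integrable M X \<longrightarrow> (\<integral>x. X x \<partial>P) = (\<integral>x. g x * X x \<partial>M)"
    and h: "h \<in> borel_measurable M"
      "\<forall>X::'a \<Rightarrow> real. integrable M X \<longrightarrow> integrable M (\<lambda>x. h x * X x)"
      "\<forall>X::'a \<Rightarrow> real. integrable M X \<longrightarrow> (\<integral>x. X x \<partial>Q) = (\<integral>x. h x * X x \<partial>M)"
    and X: "optimal_test M \<rho>\<^sub>1 \<rho>\<^sub>2 K\<^sub>1 K\<^sub>2 \<alpha> X"
  shows "AE x in M. (b * g x < a * h x \<longrightarrow> X x = K\<^sub>2 x) \<and> (b * g x > a * h x \<longrightarrow> X x = K\<^sub>1 x)"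
proof -
  define D where "D x = b * g x - a * h x" for x
  \<comment> \<open>Minimises \<open>D x * y\<close> over \<open>y\<close> between
    \<open>K\<^sub>1 x\<close> and \<open>K\<^sub>2 x\<close>; where \<open>D x = 0\<close> any
    choice in the interval would do.\<close>
  define Z where "Z x = (if D x < 0 then K\<^sub>2 x else K\<^sub>1 x)" for x
  have [measurable]: "D \<in> borel_measurable M" unfolding D_def using g(1) h(1) by measurable
  have Xt: "X \<in> tests" and X\<alpha>: "\<rho>\<^sub>1 X \<le> \<alpha>" and Xv: "risk X = optimal_value"
    using X by (auto simp: optimal_iff feasible_iff)
  note Xi = integrable_tests[OF Xt]
  note g2 = g(2)[rule_format] and g3 = g(3)[rule_format]
    and h2 = h(2)[rule_format] and h3 = h(3)[rule_format]
  have Zi: "integrable M Z"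
  proof (rule Bochner_Integration.integrable_bound)
    show "integrable M (\<lambda>x. \<bar>K\<^sub>1 x\<bar> + \<bar>K\<^sub>2 x\<bar>)" using K\<^sub>1 K\<^sub>2 by simp
    show "Z \<in> borel_measurable M" unfolding Z_def using K\<^sub>1 K\<^sub>2 by measurable
  qed (auto simp: Z_def)
  have "AE x in M. K\<^sub>1 x \<le> Z x \<and> Z x \<le> K\<^sub>2 x"
    using K_less by eventually_elim (simp add: Z_def)
  then have Zt: "Z \<in> tests" using Zi by (simp add: tests_def)
  have "a * ((\<integral>x. K\<^sub>2 x - X x \<partial>Q) - d) \<le> a * risk X"
    unfolding risk_def using a d[rule_format, of "\<lambda>x. K\<^sub>2 x - X x"] K\<^sub>2 Xi by (intro mult_left_mono) auto
  moreover have "b * ((\<integral>x. X x \<partial>P) - c) \<le> b * \<alpha>"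
    using b order_trans[OF c[rule_format, OF Xi] X\<alpha>] by (intro mult_left_mono) auto
  ultimately have le: "a * (\<integral>x. K\<^sub>2 x - X x \<partial>Q) + b * (\<integral>x. X x \<partial>P) \<le>
      a * (\<integral>x. K\<^sub>2 x - Z x \<partial>Q) + b * (\<integral>x. Z x \<partial>P)"
    using bspec[OF saddle Zt] unfolding Xv by (simp add: algebra_simps)
  have Q_eq: "(\<integral>x. K\<^sub>2 x - Y x \<partial>Q) = (\<integral>x. h x * K\<^sub>2 x \<partial>M) - (\<integral>x. h x * Y x \<partial>M)"
    if "integrable M Y" for Y
    using h3[of "\<lambda>x. K\<^sub>2 x - Y x"] h2[OF K\<^sub>2] h2[OF that] K\<^sub>2 that
    by (simp add: right_diff_distrib)
  have Di: "integrable M (\<lambda>x. D x * (X x - Z x))"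
    using g2[OF Xi] g2[OF Zi] h2[OF Xi] h2[OF Zi]
    by (simp add: D_def algebra_simps)
  have "(\<integral>x. D x * (X x - Z x) \<partial>M) =
      (\<integral>x. (b * (g x * X x) - b * (g x * Z x)) - (a * (h x * X x) - a * (h x * Z x)) \<partial>M)"
    by (intro Bochner_Integration.integral_cong) (auto simp: D_def algebra_simps)
  also have "\<dots> = (b * (\<integral>x. g x * X x \<partial>M) - b * (\<integral>x. g x * Z x \<partial>M)) -
      (a * (\<integral>x. h x * X x \<partial>M) - a * (\<integral>x. h x * Z x \<partial>M))"
    using g2[OF Xi] g2[OF Zi] h2[OF Xi] h2[OF Zi] by simp
  also have "\<dots> \<le> 0"
    using le unfolding Q_eq[OF Xi] Q_eq[OF Zi] g3[OF Xi] g3[OF Zi] by (simp add: algebra_simps)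
  finally have I0: "(\<integral>x. D x * (X x - Z x) \<partial>M) \<le> 0" .
  have nonneg: "AE x in M. 0 \<le> D x * (X x - Z x)"
    using tests_bounds[OF Xt]
    by eventually_elim (auto simp: Z_def intro: mult_nonneg_nonneg mult_nonpos_nonpos)
  have "(\<integral>x. D x * (X x - Z x) \<partial>M) = 0"
    using I0 integral_nonneg_AE[OF nonneg] by simp
  then have "AE x in M. D x * (X x - Z x) = 0"
    using integral_nonneg_eq_0_iff_AE[OF Di nonneg] by simp
  then show ?thesis
    by eventually_elim (auto simp: D_def Z_def)
qed

lemma optimal_test_structure:
  "\<exists>P \<in> representing_measures M \<rho>\<^sub>1. \<exists>Q \<in> representing_measures M \<rho>\<^sub>2. \<exists>z::ennreal.
     \<forall>X. optimal_test M \<rho>\<^sub>1 \<rho>\<^sub>2 K\<^sub>1 K\<^sub>2 \<alpha> X \<longrightarrow>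
       (AE x in M. X x = K\<^sub>2 x * indicator (lr_greater M P Q z) x
                       + X x * indicator (lr_equal M P Q z) x
                       + K\<^sub>1 x * indicator (lr_less M P Q z) x)"
proof -
  obtain a b where ab: "0 \<le> a" "0 \<le> b" "a \<noteq> 0 \<or> b \<noteq> 0"
    and mult: "\<forall>X\<in>tests. a * optimal_value + b * \<alpha> \<le> a * risk X + b * \<rho>\<^sub>1 X"
    using multipliers by (elim exE conjE)
  obtain P Q c d where P: "P \<in> representing_measures M \<rho>\<^sub>1" and Q: "Q \<in> representing_measures M \<rho>\<^sub>2"
    and c: "\<forall>W. integrable M W \<longrightarrow> (\<integral>x. W x \<partial>P) - c \<le> \<rho>\<^sub>1 W"
    and d: "\<forall>W. integrable M W \<longrightarrow> (\<integral>x. W x \<partial>Q) - d \<le> \<rho>\<^sub>2 W"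
    and saddle: "\<forall>X\<in>tests. a * optimal_value + b * \<alpha> \<le>
      a * ((\<integral>x. K\<^sub>2 x - X x \<partial>Q) - d) + b * ((\<integral>x. X x \<partial>P) - c)"
    using saddle_measures[OF ab(1,2) mult] by (elim bexE exE conjE)
  obtain g where g: "AE x in M. RN_deriv M P x = ennreal (g x)" "\<forall>x. 0 \<le> g x"
    "g \<in> borel_measurable M" "\<forall>X::'a \<Rightarrow> real. integrable M X \<longrightarrow> integrable M (\<lambda>x. g x * X x)"
    "\<forall>X::'a \<Rightarrow> real. integrable M X \<longrightarrow> (\<integral>x. X x \<partial>P) = (\<integral>x. g x * X x \<partial>M)"
    using representing_measure_density[OF prob_space_axioms P] by (elim exE conjE)
  obtain h where h: "AE x in M. RN_deriv M Q x = ennreal (h x)" "\<forall>x. 0 \<le> h x"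
    "h \<in> borel_measurable M" "\<forall>X::'a \<Rightarrow> real. integrable M X \<longrightarrow> integrable M (\<lambda>x. h x * X x)"
    "\<forall>X::'a \<Rightarrow> real. integrable M X \<longrightarrow> (\<integral>x. X x \<partial>Q) = (\<integral>x. h x * X x \<partial>M)"
    using representing_measure_density[OF prob_space_axioms Q] by (elim exE conjE)
  \<comment> \<open>If \<open>a = 0\<close>, then \<open>b > 0\<close> and the comparison of
    \<open>b * g\<close> with \<open>a * h\<close> is that of \<open>g\<close> with zero, exactly
    the convention of \<open>lr_scale\<close> at infinity. Otherwise division by \<open>a\<close>
    gives the finite threshold, including zero when \<open>b = 0\<close>.\<close>
  define z where "z = (if a = 0 then \<infinity> else ennreal (b / a))"
  have regions: "AE x in M. (x \<in> lr_greater M P Q z \<longleftrightarrow> b * g x < a * h x) \<and>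
      (x \<in> lr_equal M P Q z \<longleftrightarrow> b * g x = a * h x) \<and> (x \<in> lr_less M P Q z \<longleftrightarrow> b * g x > a * h x)"
    using g(1) h(1) AE_space
  proof eventually_elim
    case (elim x)
    show ?case
    proof (cases "a = 0")
      case True
      then have "b > 0" using ab by auto
      then show ?thesis
        using True elim g(2)[rule_format, of x]
        by (auto simp: lr_greater_def lr_equal_def lr_less_def lr_scale_def z_def
            zero_less_mult_iff mult_less_0_iff ennreal_eq_0_iff[symmetric])
    next
      case False
      then have a: "a > 0" using ab by simp
      have "z * RN_deriv M P x = ennreal (b / a) * ennreal (g x)"
        using False elim by (simp add: z_def)
      also have "\<dots> = ennreal (b / a * g x)"
        using ab g(2)[rule_format, of x] by (intro ennreal_mult[symmetric]) auto
      finally have "z * RN_deriv M P x = ennreal (b / a * g x)" .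
      moreover have "0 \<le> b / a * g x" using ab g(2)[rule_format, of x] by simp
      moreover have "z \<noteq> \<infinity>" using False by (simp add: z_def)
      ultimately show ?thesis
        using elim h(2)[rule_format, of x] a
        by (simp add: lr_greater_def lr_equal_def lr_less_def lr_scale_def ennreal_less_iff
            ennreal_inj field_simps) (auto simp: mult.commute)
    qed
  qed
  have "AE x in M. X x = K\<^sub>2 x * indicator (lr_greater M P Q z) x
      + X x * indicator (lr_equal M P Q z) x + K\<^sub>1 x * indicator (lr_less M P Q z) x"
    if X: "optimal_test M \<rho>\<^sub>1 \<rho>\<^sub>2 K\<^sub>1 K\<^sub>2 \<alpha> X" for X
    using optimal_test_bang_bang[OF ab(1,2) c d saddle g(3-5) h(3-5) X] regions
  proof eventually_elim
    case (elim x)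
    then show ?case by (cases "b * g x" "a * h x" rule: linorder_cases) (auto simp: indicator_def)
  qed
  then show ?thesis using P Q by (intro bexI[of _ P] bexI[of _ Q] exI[of _ z] allI impI)
qed

end

theorem theorem6p4:
  fixes M :: "'a measure"
    and \<rho>\<^sub>1 \<rho>\<^sub>2 :: "('a \<Rightarrow> real) \<Rightarrow> real"
    and K\<^sub>1 K\<^sub>2 :: "'a \<Rightarrow> real"
    and \<alpha> :: real
  assumes "prob_space M"
    and "convex_expectation M \<rho>\<^sub>1"
    and "convex_expectation M \<rho>\<^sub>2"
    and "integrable M K\<^sub>1"
    and "integrable M K\<^sub>2"
    and "AE x in M. 0 \<le> K\<^sub>1 x \<and> K\<^sub>1 x < K\<^sub>2 x"
    and "\<rho>\<^sub>1 K\<^sub>1 \<le> \<alpha>"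
    and "\<alpha> \<le> \<rho>\<^sub>1 K\<^sub>2"
  shows "(\<exists>X. optimal_test M \<rho>\<^sub>1 \<rho>\<^sub>2 K\<^sub>1 K\<^sub>2 \<alpha> X) \<and>
    (\<exists>P \<in> representing_measures M \<rho>\<^sub>1. \<exists>Q \<in> representing_measures M \<rho>\<^sub>2.
       \<forall>X. optimal_test M \<rho>\<^sub>1 \<rho>\<^sub>2 K\<^sub>1 K\<^sub>2 \<alpha> X \<longrightarrow>
         (\<exists>(z::ennreal) B. B \<in> borel_measurable M \<and>
            (AE x in M. K\<^sub>1 x \<le> B x \<and> B x \<le> K\<^sub>2 x) \<and>
            (AE x in M. X x = K\<^sub>2 x * indicator (lr_greater M P Q z) x
                            + B x * indicator (lr_equal M P Q z) x
                            + K\<^sub>1 x * indicator (lr_less M P Q z) x)))"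
proof -
  interpret prob_space M by fact
  interpret test_problem M \<rho>\<^sub>1 \<rho>\<^sub>2 K\<^sub>1 K\<^sub>2 \<alpha>
  proof
    show "AE x in M. K\<^sub>1 x < K\<^sub>2 x" using assms(6) by eventually_elim simp
  qed (use assms in auto)
  obtain P Q z where P: "P \<in> representing_measures M \<rho>\<^sub>1" and Q: "Q \<in> representing_measures M \<rho>\<^sub>2"
    and *: "\<forall>X. optimal_test M \<rho>\<^sub>1 \<rho>\<^sub>2 K\<^sub>1 K\<^sub>2 \<alpha> X \<longrightarrow>
      (AE x in M. X x = K\<^sub>2 x * indicator (lr_greater M P Q z) x
        + X x * indicator (lr_equal M P Q z) x + K\<^sub>1 x * indicator (lr_less M P Q z) x)"
    using optimal_test_structure by (elim bexE exE)
  have "\<exists>z B. B \<in> borel_measurable M \<and> (AE x in M. K\<^sub>1 x \<le> B x \<and> B x \<le> K\<^sub>2 x) \<and>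
      (AE x in M. X x = K\<^sub>2 x * indicator (lr_greater M P Q z) x
        + B x * indicator (lr_equal M P Q z) x + K\<^sub>1 x * indicator (lr_less M P Q z) x)"
    if X: "optimal_test M \<rho>\<^sub>1 \<rho>\<^sub>2 K\<^sub>1 K\<^sub>2 \<alpha> X" for X
  \<comment> \<open>The test itself serves as \<open>B\<close>: it lies in the interval, and on the
    equality region its values are left free.\<close>
  proof (rule exI[of _ z], rule exI[of _ X], intro conjI)
    have "X \<in> tests" using X by (simp add: optimal_iff feasible_iff)
    then show "X \<in> borel_measurable M" "AE x in M. K\<^sub>1 x \<le> X x \<and> X x \<le> K\<^sub>2 x"
      using integrable_tests[of X] tests_bounds[of X] by auto
  qed (rule *[rule_format, OF X])
  then show ?thesis
    using ex_optimal_test P Q by (intro conjI bexI[of _ P] bexI[of _ Q] allI impI)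
qed

end
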